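(* Let $S$ be a finite alphabet and let $E$ be a system of relations over $S^{\pm}$. Let $\mathrm{FGSol}_E$ denote the set of (isomorphism classes of) graphs in $\mathrm{GSol}_E$ that are finite and connected. If $\mathrm{FGSol}_E$ is infinite and $\inf\{h(G) : G\in\mathrm{FGSol}_E\}>0$, then $E$ is not testable.
   Context: Words and relations. $S=\{s_1,\dots,s_d\}$ is a finite alphabet, $S^{-}=\{s_1^{-1},\dots,s_d^{-1}\}$ is the set of formal inverses, $S^{\pm}=S\cup S^{-}$. A system of relations $E=\{w_{i,1}=w_{i,2}\}_{i=1}^r$ over $S^{\pm}$ is a finite set of formal equations between words over $S^{\pm}$. $S$-graphs. An $S$-graph is a (finite or infinite) directed graph (with nonempty vertex set; self-loops and multiple edges allowed) whose edges are labelled by elements of $S$, such that for each $s\in S$ every vertex has exactly one outgoing and exactly one incoming edge labelled $s$. For a vertex $x$ and $s\in S$, $s_Gx$ is the endpoint of the $s$-labelled edge leaving $x$, and $s_G^{-1}x$ is the origin of the $s$-labelled edge entering $x$; for a word $w=w_t\cdots w_1$ with $w_i\in S^{\pm}$, $w_Gx=(w_t)_G(\cdots((w_1)_Gx))$. Connectedness of an $S$-graph disregards edge orientation and labels. $\mathcal G_S(n)$ is the set of $S$-graphs with vertex set $[n]=\{1,\dots,n\}$. $\mathrm{GSol}_E$ is the class of all $S$-graphs $G$ (finite or infinite) such that $(w_{i,1})_Gx=(w_{i,2})_Gx$ for every $1\le i\le r$ and every vertex $x$; $\mathrm{GSol}_E(n)=\mathrm{GSol}_E\cap\mathcal G_S(n)$.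 Cheeger constant. For a finite graph $G$ with vertex set $V$ (edge orientations and labels are ignored), $h(G)=\inf\{|E(X,V\setminus X)|/|X| : X\subseteq V,\ 1\le|X|\le |V|/2\}$, where $E(X,Y)$ is the set of edges between $X$ and $Y$ (and $\inf\emptyset=+\infty$). Testability. For $G,G'\in\mathcal G_S(n)$ let $d^{\mathrm H}(G,G')=\sum_{s\in S}\frac1n|\{x\in[n]: s_Gx\ne s_{G'}x\}|$, and for $\varepsilon>0$ let $\mathrm{GSol}_E^{\ge\varepsilon}(n)=\{G\in\mathcal G_S(n): d^{\mathrm H}(G,G')\ge\varepsilon\ \forall G'\in\mathrm{GSol}_E(n)\}$. A (randomized, adaptive) algorithm that takes $n\in\mathbb N$ and has query access to $G\in\mathcal G_S(n)$ is an $(\varepsilon,q)$-tester for $E$ if: it accepts with probability at least $0.99$ whenever $G\in\mathrm{GSol}_E(n)$; it rejects with probability at least $0.99$ whenever $G\in\mathrm{GSol}_E^{\ge\varepsilon}(n)$; and it makes at most $q$ queries, each of the form "what is $s_Gx$?" with $x\in[n]$, $s\in S^{\pm}$. There is no restriction on running time. $E$ is testable if for every $\varepsilon>0$ there are $q=q(\varepsilon)\in\mathbb N$ (independent of $n$) and an $(\varepsilon,q)$-tester for $E$. *)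

theory Defs
  imports "HOL-Probability.Probability_Mass_Function"
begin

text \<open>
  The alphabet is a finite type \<open>'s\<close>. A word \<open>w\<^sub>t \<cdots> w\<^sub>1\<close> is the list \<open>[w\<^sub>t, \<dots>, w\<^sub>1]\<close>,
  so the head of the list acts last.
\<close>

datatype 's letter = Pos 's | Neg 's

type_synonym 's sword = "'s letter list"

type_synonym 's relations = "('s sword \<times> 's sword) set"

text \<open>
  The triple \<open>(x, s, y)\<close> is an edge from \<open>x\<close> to \<open>y\<close> labelled \<open>s\<close>. Triples suffice: an \<open>S\<close>-graph
  has no two edges with the same label and the same origin, while edges with different labels
  between the same endpoints are different triples.
\<close>

record ('v, 's) labelled_graph =
  vertices :: "'v set"
  edges :: "('v \<times> 's \<times> 'v) set"

definition S_graph :: "('v, 's) labelled_graph \<Rightarrow> bool" where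
  "S_graph G \<longleftrightarrow>
     vertices G \<noteq> {} \<and>
     edges G \<subseteq> vertices G \<times> UNIV \<times> vertices G \<and>
     (\<forall>s. \<forall>x\<in>vertices G. (\<exists>!y. (x, s, y) \<in> edges G) \<and> (\<exists>!y. (y, s, x) \<in> edges G))"

fun letter_act :: "('v, 's) labelled_graph \<Rightarrow> 's letter \<Rightarrow> 'v \<Rightarrow> 'v" where
  "letter_act G (Pos s) x = (THE y. (x, s, y) \<in> edges G)"
| "letter_act G (Neg s) x = (THE y. (y, s, x) \<in> edges G)"

definition word_act :: "('v, 's) labelled_graph \<Rightarrow> 's sword \<Rightarrow> 'v \<Rightarrow> 'v" where
  "word_act G w x = foldr (letter_act G) w x"

definition connected_graph :: "('v, 's) labelled_graph \<Rightarrow> bool" where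
  "connected_graph G \<longleftrightarrow>
     (\<forall>x\<in>vertices G. \<forall>y\<in>vertices G.
        (\<lambda>u v. \<exists>s. (u, s, v) \<in> edges G \<or> (v, s, u) \<in> edges G)\<^sup>*\<^sup>* x y)"

definition graph_iso :: "('v, 's) labelled_graph \<Rightarrow> ('w, 's) labelled_graph \<Rightarrow> bool" where
  "graph_iso G H \<longleftrightarrow>
     (\<exists>f. bij_betw f (vertices G) (vertices H) \<and>
       (\<forall>s. \<forall>x\<in>vertices G. \<forall>y\<in>vertices G. (x, s, y) \<in> edges G \<longleftrightarrow> (f x, s, f y) \<in> edges H))"

definition S_graphs :: "nat \<Rightarrow> (nat, 's) labelled_graph set" where
  "S_graphs n = {G. S_graph G \<and> vertices G = {1..n}}"

definition GSol :: "'s relations \<Rightarrow> ('v, 's) labelled_graph set" where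
  "GSol E = {G. S_graph G \<and>
     (\<forall>(w1, w2)\<in>E. \<forall>x\<in>vertices G. word_act G w1 x = word_act G w2 x)}"

definition GSol_n :: "'s relations \<Rightarrow> nat \<Rightarrow> (nat, 's) labelled_graph set" where
  "GSol_n E n = GSol E \<inter> S_graphs n"

text \<open>
  Every finite graph is isomorphic to one whose vertices are natural numbers, so the isomorphism
  classes of finite graphs are formed over that vertex type.
\<close>

definition finite_connected_GSol :: "'s relations \<Rightarrow> (nat, 's) labelled_graph set" where
  "finite_connected_GSol E = {G \<in> GSol E. finite (vertices G) \<and> connected_graph G}"

definition FGSol :: "'s relations \<Rightarrow> (nat, 's) labelled_graph set set" where
  "FGSol E = finite_connected_GSol E //
     {(G, H). G \<in> finite_connected_GSol E \<and> H \<in> finite_connected_GSol E \<and> graph_iso G H}"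

definition edges_between ::
    "('v, 's) labelled_graph \<Rightarrow> 'v set \<Rightarrow> 'v set \<Rightarrow> ('v \<times> 's \<times> 'v) set" where
  "edges_between G X Y =
     {(x, s, y). (x, s, y) \<in> edges G \<and> (x \<in> X \<and> y \<in> Y \<or> x \<in> Y \<and> y \<in> X)}"

definition cheeger :: "('v, 's) labelled_graph \<Rightarrow> ereal" where
  "cheeger G =
     Inf {ereal (real (card (edges_between G X (vertices G - X))) / real (card X)) |X.
            X \<subseteq> vertices G \<and> 1 \<le> card X \<and> real (card X) \<le> real (card (vertices G)) / 2}"

definition hamming_dist ::
    "nat \<Rightarrow> (nat, 's::finite) labelled_graph \<Rightarrow> (nat, 's) labelled_graph \<Rightarrow> real" where
  "hamming_dist n G G' =
     (\<Sum>s\<in>UNIV. 1 / real n *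
        real (card {x \<in> {1..n}. letter_act G (Pos s) x \<noteq> letter_act G' (Pos s) x}))"

definition GSol_far :: "('s::finite) relations \<Rightarrow> real \<Rightarrow> nat \<Rightarrow> (nat, 's) labelled_graph set" where
  "GSol_far E \<epsilon> n = {G \<in> S_graphs n. \<forall>G'\<in>GSol_n E n. hamming_dist n G G' \<ge> \<epsilon>}"

text \<open>
  A deterministic adaptive query algorithm is a decision tree: either it halts with a verdict
  (\<open>True\<close> for accept), or it asks for the image of a vertex under a letter and continues according
  to the answer. A randomized algorithm is a probability distribution on such trees, all coins
  being tossed in advance. Discrete distributions lose no generality, because for fixed \<open>n\<close> and \<open>q\<close>
  trees making at most \<open>q\<close> queries in \<open>[n]\<close> have only finitely many different behaviours on the
  finitely many inputs. The distribution may depend on \<open>n\<close> arbitrarily.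
\<close>

datatype 's query_tree =
    Verdict bool
  | Query nat "'s letter" "nat \<Rightarrow> 's query_tree"

primrec accepts :: "(nat, 's) labelled_graph \<Rightarrow> 's query_tree \<Rightarrow> bool" where
  "accepts G (Verdict b) = b"
| "accepts G (Query x l k) = accepts G (k (letter_act G l x))"

primrec queries :: "(nat, 's) labelled_graph \<Rightarrow> 's query_tree \<Rightarrow> (nat \<times> 's letter) list" where
  "queries G (Verdict b) = []"
| "queries G (Query x l k) = (x, l) # queries G (k (letter_act G l x))"

definition tester ::
    "('s::finite) relations \<Rightarrow> real \<Rightarrow> nat \<Rightarrow> (nat \<Rightarrow> 's query_tree pmf) \<Rightarrow> bool" where
  "tester E \<epsilon> q A \<longleftrightarrow>
     (\<forall>n.
        (\<forall>G\<in>S_graphs n. \<forall>t\<in>set_pmf (A n).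
           length (queries G t) \<le> q \<and> fst ` set (queries G t) \<subseteq> {1..n}) \<and>
        (\<forall>G\<in>GSol_n E n. measure_pmf.prob (A n) {t. accepts G t} \<ge> 0.99) \<and>
        (\<forall>G\<in>GSol_far E \<epsilon> n. measure_pmf.prob (A n) {t. \<not> accepts G t} \<ge> 0.99))"

definition testable :: "('s::finite) relations \<Rightarrow> bool" where
  "testable E \<longleftrightarrow> (\<forall>\<epsilon>>0. \<exists>q A. tester E \<epsilon> q A)"

end

theory Submission
  imports Defs "HOL-Combinatorics.Permutations" "HOL-Library.FuncSet"
begin

text \<open>
  Since there are infinitely many finite connected solutions, two of them, \<open>H\<^sub>1\<close> and a much larger
  \<open>H\<^sub>2\<close>, have nearly the same statistics of local neighbourhoods. Remove between \<open>1\<close> and \<open>|H\<^sub>1|\<close>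
  vertices from \<open>H\<^sub>2\<close> so that the number \<open>n\<close> of remaining ones is a multiple of \<open>|H\<^sub>1|\<close>, and repair
  the result to an \<open>S\<close>-graph \<open>G\<close>. A tester with few queries cannot tell a random relabelling of
  \<open>G\<close> from a random relabelling of \<open>n / |H\<^sub>1|\<close> disjoint copies of \<open>H\<^sub>1\<close>, which is a solution.

  But \<open>G\<close> is far from every solution \<open>G'\<close> on \<open>n\<close> vertices: if not, the graph of the inclusion of
  the vertices of \<open>G\<close> into \<open>H\<^sub>2\<close> would be a set with small boundary in the solution \<open>H\<^sub>2 \<times> G'\<close>. By
  expansion it would fill more than half of some component of that product. The fibres of this
  component over its image in \<open>G'\<close> all have the same size, so they would be singletons and the
  component would have at most \<open>n < |H\<^sub>2|\<close> vertices, although it projects onto \<open>H\<^sub>2\<close>.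
\<close>

section \<open>Permutation actions\<close>

text \<open>The constants are fixed in the order \<open>c\<close>, \<open>q\<close>,
  \<open>R\<close>, \<open>N1\<close>, \<open>N2\<close>. The size \<open>N1\<close> of the small
  solution comes out of a pigeonhole over rounded frequencies of local types, and the cost of the
  repair is proportional to it; \<open>N2\<close> can absorb that cost because the pigeonhole class
  is infinite. At least one vertex has to be removed, since an untouched \<open>H\<^sub>2\<close> is
  a solution.

  The expansion hypothesis has to hold for all finite connected solutions, not only for
  \<open>H\<^sub>2\<close>: it is applied to the components of the product with \<open>G'\<close>,
  which are again such solutions, while \<open>G'\<close> itself may be disconnected.

  The random relabelling makes names uninformative. The comparison is made for one fixed decision
  tree, found by averaging over the coins of the tester, so it amounts to counting the relabellings
  on which that tree accepts.\<close>

fun lact :: "('s \<Rightarrow> 'v \<Rightarrow> 'v) \<Rightarrow> 's letter \<Rightarrow> 'v \<Rightarrow> 'v" where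
  "lact f (Pos s) = f s"
| "lact f (Neg s) = inv (f s)"

definition wact :: "('s \<Rightarrow> 'v \<Rightarrow> 'v) \<Rightarrow> 's sword \<Rightarrow> 'v \<Rightarrow> 'v" where
  "wact f w x = foldr (lact f) w x"

lemma wact_Nil [simp]: "wact f [] x = x"
  and wact_Cons [simp]: "wact f (l # w) x = lact f l (wact f w x)"
  and wact_append: "wact f (u @ w) x = wact f u (wact f w x)"
  by (simp_all add: wact_def)

fun letter_inv :: "'s letter \<Rightarrow> 's letter" where
  "letter_inv (Pos s) = Neg s"
| "letter_inv (Neg s) = Pos s"

definition word_inv :: "'s sword \<Rightarrow> 's sword" where
  "word_inv w = rev (map letter_inv w)"

lemma length_word_inv [simp]: "length (word_inv w) = length w"
  by (simp add: word_inv_def)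

text \<open>The permutations need not be the identity outside \<open>V\<close>; this makes products of actions and
  restrictions to orbits actions again.\<close>

definition perm_action :: "'v set \<Rightarrow> ('s \<Rightarrow> 'v \<Rightarrow> 'v) \<Rightarrow> bool" where
  "perm_action V f \<longleftrightarrow> (\<forall>s. bij (f s) \<and> f s ` V = V)"

lemma perm_actionI: "(\<And>s. f s permutes V) \<Longrightarrow> perm_action V f"
  by (auto simp: perm_action_def permutes_image intro: permutes_bij)

lemma perm_actionD:
  assumes "perm_action V f"
  shows "bij (f s)" "f s x \<in> V \<longleftrightarrow> x \<in> V" "f s (inv (f s) x) = x" "inv (f s) (f s x) = x"
    "inv (f s) x \<in> V \<longleftrightarrow> x \<in> V"
proof -
  show bij: "bij (f s)" using assms by (simp add: perm_action_def)
  have V: "f s ` V = V" using assms by (simp add: perm_action_def)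
  show in_iff: "f s x \<in> V \<longleftrightarrow> x \<in> V" for x
    using inj_image_mem_iff[OF bij_is_inj[OF bij], of x V] by (simp only: V)
  show inv: "f s (inv (f s) x) = x"
    using bij by (simp add: bij_is_surj surj_f_inv_f)
  show "inv (f s) (f s x) = x"
    using bij by (simp add: bij_is_inj)
  show "inv (f s) x \<in> V \<longleftrightarrow> x \<in> V"
    using in_iff[of "inv (f s) x"] by (simp only: inv)
qed

lemma lact_in: "perm_action V f \<Longrightarrow> lact f l x \<in> V \<longleftrightarrow> x \<in> V"
  by (cases l) (simp_all add: perm_actionD(2,5))

lemma wact_in: "perm_action V f \<Longrightarrow> wact f w x \<in> V \<longleftrightarrow> x \<in> V"
  by (induction w) (simp_all add: lact_in)

lemma lact_letter_inv:
  assumes "perm_action V f"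
  shows "lact f (letter_inv l) (lact f l x) = x" "lact f l (lact f (letter_inv l) x) = x"
proof -
  note inverses = perm_actionD(3,4)[OF assms]
  show "lact f (letter_inv l) (lact f l x) = x"
    by (cases l) (simp_all add: inverses)
  show "lact f l (lact f (letter_inv l) x) = x"
    by (cases l) (simp_all add: inverses)
qed

lemma inj_lact: "perm_action V f \<Longrightarrow> inj (lact f l)"
  by (metis injI lact_letter_inv(1))

lemma lact_eq_iff:
  assumes "perm_action V f"
  shows "x = lact f l y \<longleftrightarrow> lact f (letter_inv l) x = y"
  using lact_letter_inv[OF assms] by metis

lemma wact_word_inv:
  assumes "perm_action V f"
  shows "wact f (word_inv w) (wact f w x) = x"
  by (induction w arbitrary: x)
    (auto simp: word_inv_def wact_append lact_letter_inv[OF assms])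

section \<open>Labelled graphs as permutation actions\<close>

definition graph_of :: "'v set \<Rightarrow> ('s \<Rightarrow> 'v \<Rightarrow> 'v) \<Rightarrow> ('v, 's) labelled_graph" where
  "graph_of V f = \<lparr>vertices = V, edges = {(x, s, f s x) |x s. x \<in> V}\<rparr>"

lemma vertices_graph_of [simp]: "vertices (graph_of V f) = V"
  by (simp add: graph_of_def)

lemma edges_graph_of: "(x, s, y) \<in> edges (graph_of V f) \<longleftrightarrow> x \<in> V \<and> y = f s x"
  by (auto simp: graph_of_def)

lemma S_graph_graph_of:
  assumes "perm_action V f" "V \<noteq> {}"
  shows "S_graph (graph_of V f)"
proof -
  note f = perm_actionD[OF assms(1)]
  have "\<exists>!y. y \<in> V \<and> x = f s y" if "x \<in> V" for x s
  proof (intro ex1I[of _ "inv (f s) x"])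
    show "inv (f s) x \<in> V \<and> x = f s (inv (f s) x)"
      using f that by simp
    show "y = inv (f s) x" if "y \<in> V \<and> x = f s y" for y
      using f that by simp
  qed
  moreover have "edges (graph_of V f) \<subseteq> V \<times> UNIV \<times> V"
    using f(2) by (auto simp: graph_of_def)
  ultimately show ?thesis
    using assms(2) f(2) by (simp add: S_graph_def edges_graph_of)
qed

lemma letter_act_graph_of:
  assumes "perm_action V f" "x \<in> V"
  shows "letter_act (graph_of V f) l x = lact f l x"
proof (cases l)
  case (Pos s)
  then show ?thesis using assms by (simp add: edges_graph_of)
next
  case (Neg s)
  note f = perm_actionD[OF assms(1)]
  have "(THE y. y \<in> V \<and> x = f s y) = inv (f s) x"
  proof (rule the_equality)
    show "inv (f s) x \<in> V \<and> x = f s (inv (f s) x)"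
      using f assms(2) by simp
    show "y = inv (f s) x" if "y \<in> V \<and> x = f s y" for y
      using f that by simp
  qed
  with Neg show ?thesis by (simp add: edges_graph_of)
qed

lemma word_act_graph_of:
  assumes "perm_action V f" "x \<in> V"
  shows "word_act (graph_of V f) w x = wact f w x"
proof (induction w)
  case (Cons l w)
  then show ?case
    using letter_act_graph_of[OF assms(1)] wact_in[OF assms(1)] assms(2)
    by (simp add: word_act_def)
qed (simp add: word_act_def)

text \<open>Finiteness turns injectivity into surjectivity, and setting \<open>f s\<close> to the
  identity outside the vertices makes it a permutation of the whole type. From here on a finite
  graph can be exchanged for its permutations.\<close>

lemma S_graph_imp_perm_action:
  assumes "S_graph G" "finite (vertices G)"
  obtains f where "perm_action (vertices G) f" "G = graph_of (vertices G) f"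
proof -
  define V where "V = vertices G"
  define f where "f = (\<lambda>s x. if x \<in> V then THE y. (x, s, y) \<in> edges G else x)"
  have sub: "edges G \<subseteq> V \<times> UNIV \<times> V"
    and out: "\<And>s x. x \<in> V \<Longrightarrow> \<exists>!y. (x, s, y) \<in> edges G"
    and inn: "\<And>s x. x \<in> V \<Longrightarrow> \<exists>!y. (y, s, x) \<in> edges G"
    using assms(1) by (auto simp: S_graph_def V_def)
  have fe: "(x, s, f s x) \<in> edges G" if "x \<in> V" for s x
    unfolding f_def using theI'[OF out[OF that]] that by simp
  have fe_iff: "(x, s, y) \<in> edges G \<longleftrightarrow> x \<in> V \<and> y = f s x" for x s y
  proof
    assume e: "(x, s, y) \<in> edges G"
    then have "x \<in> V" using sub by auto
    with e show "x \<in> V \<and> y = f s x" using fe[OF \<open>x \<in> V\<close>] out[OF \<open>x \<in> V\<close>] by auto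
  qed (use fe in auto)
  have fin: "f s x \<in> V" if "x \<in> V" for s x
    using fe[OF that] sub by auto
  have perm: "f s permutes V" for s
  proof (rule bij_imp_permutes)
    have "inj_on (f s) V"
    proof (rule inj_onI)
      fix x y assume "x \<in> V" "y \<in> V" "f s x = f s y"
      then show "x = y" using fe[of x s] fe[of y s] inn[OF fin[of x s], of s] by auto
    qed
    moreover have "f s ` V \<subseteq> V" using fin by auto
    ultimately show "bij_betw (f s) V V"
      using assms(2) by (simp add: V_def bij_betw_def endo_inj_surj)
  qed (simp add: f_def)
  have G: "G = graph_of V f"
  proof -
    have "edges G = {(x, s, f s x) |x s. x \<in> V}" using fe_iff by auto
    then show ?thesis by (simp add: graph_of_def V_def)
  qed
  show ?thesis
    by (rule that[of f]) (use perm G in \<open>simp_all add: perm_actionI flip: V_def\<close>)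
qed

definition satisfies :: "'s relations \<Rightarrow> 'v set \<Rightarrow> ('s \<Rightarrow> 'v \<Rightarrow> 'v) \<Rightarrow> bool" where
  "satisfies E V f \<longleftrightarrow> (\<forall>(w1, w2)\<in>E. \<forall>x\<in>V. wact f w1 x = wact f w2 x)"

lemma graph_of_GSol_iff:
  assumes "perm_action V f" "V \<noteq> {}"
  shows "graph_of V f \<in> GSol E \<longleftrightarrow> satisfies E V f"
  using S_graph_graph_of[OF assms] word_act_graph_of[OF assms(1)]
  by (auto simp: GSol_def satisfies_def split: prod.splits)

text \<open>Words contain formal inverses, so this is the component of \<open>x\<close> with edge
  orientation disregarded.\<close>

definition orbit :: "('s \<Rightarrow> 'v \<Rightarrow> 'v) \<Rightarrow> 'v \<Rightarrow> 'v set" where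
  "orbit f x = {wact f w x |w. True}"

lemma orbit_self: "x \<in> orbit f x"
  unfolding orbit_def by (auto intro: exI[of _ "[]"])

lemma orbit_subset: "perm_action V f \<Longrightarrow> x \<in> V \<Longrightarrow> orbit f x \<subseteq> V"
  by (auto simp: orbit_def wact_in)

lemma orbit_eq:
  assumes "perm_action V f" "y \<in> orbit f x"
  shows "orbit f y = orbit f x"
proof -
  obtain w where y: "y = wact f w x" using assms(2) by (auto simp: orbit_def)
  then have x: "x = wact f (word_inv w) y" by (simp add: wact_word_inv[OF assms(1)])
  have sub: "orbit f (wact f u z) \<subseteq> orbit f z" for u z
    by (auto simp: orbit_def simp flip: wact_append)
  show ?thesis
    using sub[of w x, folded y] sub[of "word_inv w" y, folded x] by (rule subset_antisym)
qed

lemma connected_graph_of_iff: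
  assumes "perm_action V f"
  shows "connected_graph (graph_of V f) \<longleftrightarrow> (\<forall>x\<in>V. orbit f x = V)"
proof -
  define R where "R = (\<lambda>u v. \<exists>s. (u, s, v) \<in> edges (graph_of V f) \<or> (v, s, u) \<in> edges (graph_of V f))"
  have R_iff: "R u v \<longleftrightarrow> u \<in> V \<and> (\<exists>l. v = lact f l u)" for u v
  proof
    assume "R u v"
    then obtain s where "u \<in> V \<and> v = f s u \<or> v \<in> V \<and> u = f s v"
      by (auto simp: R_def edges_graph_of)
    then show "u \<in> V \<and> (\<exists>l. v = lact f l u)"
    proof
      assume "u \<in> V \<and> v = f s u"
      then show ?thesis by (auto intro: exI[of _ "Pos s"])
    next
      assume *: "v \<in> V \<and> u = f s v"
      then have "v = lact f (Neg s) u" using lact_letter_inv(1)[OF assms, of "Pos s" v] by simp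
      moreover have "u \<in> V" using * lact_in[OF assms, of "Pos s" v] by simp
      ultimately show ?thesis by blast
    qed
  next
    assume "u \<in> V \<and> (\<exists>l. v = lact f l u)"
    then obtain l where u: "u \<in> V" and v: "v = lact f l u" by blast
    then have "v \<in> V" using lact_in[OF assms] by blast
    with u v lact_letter_inv(2)[OF assms, of l] show "R u v"
    proof (cases l)
      case (Pos s)
      with u v show ?thesis by (auto simp: R_def edges_graph_of)
    next
      case (Neg s)
      then have "u = f s v" using v lact_letter_inv(2)[OF assms, of "Pos s" u] by simp
      with \<open>v \<in> V\<close> show ?thesis by (auto simp: R_def edges_graph_of)
    qed
  qed
  have reach: "R\<^sup>*\<^sup>* x y \<longleftrightarrow> y \<in> orbit f x" if x: "x \<in> V" for x y
  proof
    assume "R\<^sup>*\<^sup>* x y"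
    then show "y \<in> orbit f x"
    proof induction
      case base
      show ?case by (rule orbit_self)
    next
      case (step y z)
      then obtain l w where "z = lact f l y" "y = wact f w x"
        by (auto simp: R_iff orbit_def)
      then have "z = wact f (l # w) x" by simp
      then show ?case unfolding orbit_def by blast
    qed
  next
    assume "y \<in> orbit f x"
    then obtain w where "y = wact f w x" by (auto simp: orbit_def)
    moreover have "R\<^sup>*\<^sup>* x (wact f w x)" for w
    proof (induction w)
      case (Cons l w)
      have "R (wact f w x) (wact f (l # w) x)"
        using x assms by (auto simp: R_iff wact_in)
      with Cons show ?case by (rule rtranclp.rtrancl_into_rtrancl)
    qed simp
    ultimately show "R\<^sup>*\<^sup>* x y" by simp
  qed
  have "connected_graph (graph_of V f) \<longleftrightarrow> (\<forall>x\<in>V. \<forall>y\<in>V. R\<^sup>*\<^sup>* x y)"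
    by (simp add: connected_graph_def R_def)
  also have "\<dots> \<longleftrightarrow> (\<forall>x\<in>V. orbit f x = V)"
    using reach orbit_subset[OF assms] by blast
  finally show ?thesis .
qed

text \<open>Conjugation of \<open>f\<close> by \<open>b\<close>, extended by the identity. Products
  live on pairs, whereas the Cheeger hypothesis speaks of graphs on natural numbers and testers of
  graphs on \<open>{1..n}\<close>.\<close>

definition transport :: "'w set \<Rightarrow> ('w \<Rightarrow> 'v) \<Rightarrow> ('s \<Rightarrow> 'v \<Rightarrow> 'v) \<Rightarrow> 's \<Rightarrow> 'w \<Rightarrow> 'w" where
  "transport W b f s x = (if x \<in> W then inv_into W b (f s (b x)) else x)"

lemma
  assumes "bij_betw b W V" "perm_action V f"
  shows perm_action_transport: "perm_action W (transport W b f)"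
    and wact_transport: "x \<in> W \<Longrightarrow> b (wact (transport W b f) w x) = wact f w (b x)"
proof -
  let ?g = "transport W b f"
  have bV: "b x \<in> V" if "x \<in> W" for x using assms(1) that by (rule bij_betw_apply)
  have fV: "bij_betw (f s) V V" for s
    using perm_actionD(1)[OF assms(2), of s] assms(2)
    by (auto simp: perm_action_def intro: bij_betw_subset)
  have bij: "bij_betw (inv_into W b \<circ> (f s \<circ> b)) W W" for s
    using bij_betw_trans[OF bij_betw_trans[OF assms(1) fV] bij_betw_inv_into[OF assms(1)]] .
  have "bij_betw (?g s) W W" for s
    using bij[of s] by (subst bij_betw_cong[of W _ "inv_into W b \<circ> (f s \<circ> b)"]) (auto simp: transport_def)
  then show pg: "perm_action W ?g"
    by (auto intro!: perm_actionI bij_imp_permutes simp: transport_def)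
  have bg: "b (?g s x) = f s (b x)" if "x \<in> W" for s x
    using that assms(1) fV[of s] bV[OF that] 
    by (auto simp: transport_def bij_betw_def intro!: f_inv_into_f)
  have bl: "b (lact ?g l x) = lact f l (b x)" if "x \<in> W" for l x
  proof (cases l)
    case (Pos s)
    then show ?thesis using bg that by simp
  next
    case (Neg s)
    have "lact ?g (Neg s) x \<in> W" using that by (simp only: lact_in[OF pg])
    \<comment> \<open>Since \<open>b\<close> intertwines the generators, evaluating this at the
      preimage of \<open>x\<close> settles the inverse letters.\<close>
    from bg[OF this, of s] have "b x = lact f (Pos s) (b (lact ?g (Neg s) x))"
      using lact_letter_inv(2)[OF pg, of "Pos s" x] by simp
    with lact_eq_iff[OF assms(2)] Neg show ?thesis by fastforce
  qed
  show "b (wact ?g w x) = wact f w (b x)" if "x \<in> W"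
    using that by (induction w) (simp_all add: bl wact_in[OF pg])
qed

lemma wact_transport_eq_iff:
  assumes "bij_betw b W V" "perm_action V f" "x \<in> W" "y \<in> W"
  shows "wact (transport W b f) w x = y \<longleftrightarrow> wact f w (b x) = b y"
proof -
  have "wact (transport W b f) w x \<in> W"
    using assms(3) by (simp add: wact_in[OF perm_action_transport[OF assms(1,2)]])
  then show ?thesis
    using assms(1,4) wact_transport[OF assms(1-3), of w] by (metis bij_betw_def inj_on_eq_iff)
qed

lemma satisfies_transport:
  assumes "bij_betw b W V" "perm_action V f" "satisfies E V f"
  shows "satisfies E W (transport W b f)"
proof -
  have "wact (transport W b f) w1 x = wact (transport W b f) w2 x"
    if "(w1, w2) \<in> E" "x \<in> W" for w1 w2 x
  proof -
    have "b x \<in> V" using assms(1) that(2) by (rule bij_betw_apply)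
    then have "wact f w1 (b x) = wact f w2 (b x)"
      using assms(3) that(1) by (auto simp: satisfies_def)
    then have "b (wact (transport W b f) w1 x) = b (wact (transport W b f) w2 x)"
      using wact_transport[OF assms(1,2) that(2)] by simp
    moreover have "wact (transport W b f) w x \<in> W" for w
      using that(2) by (simp add: wact_in[OF perm_action_transport[OF assms(1,2)]])
    ultimately show ?thesis using assms(1) by (metis bij_betw_def inj_on_eq_iff)
  qed
  then show ?thesis by (auto simp: satisfies_def)
qed

section \<open>Expansion and products of solutions\<close>

text \<open>The Cheeger constant counts edges in both directions, the right-hand side only those
  leaving \<open>X\<close>. A permutation moves as many points into a finite set as out of it,
  whence the factor 2. The action is moved to an initial segment of the natural numbers, where
  \<open>c\<close> applies.\<close>

lemma cheeger_boundary:
  fixes f :: "'s::finite \<Rightarrow> 'v \<Rightarrow> 'v"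
  assumes f: "perm_action V f" "finite V" "satisfies E V f" "\<And>x. x \<in> V \<Longrightarrow> orbit f x = V"
    and c: "\<And>G. G \<in> finite_connected_GSol E \<Longrightarrow> ereal c \<le> cheeger G"
    and X: "X \<subseteq> V" "X \<noteq> {}" "2 * card X \<le> card V"
  shows "c * card X \<le> 2 * (\<Sum>s\<in>UNIV. real (card {x\<in>X. f s x \<notin> X}))"
proof -
  define W where "W = {0..<card V}"
  obtain b where b: "bij_betw b W V"
    using ex_bij_betw_nat_finite[OF f(2)] by (auto simp: W_def)
  define g where "g = transport W b f"
  define Y where "Y = {y\<in>W. b y \<in> X}"
  have finW: "finite W" by (simp add: W_def)
  have finX: "finite X" using X(1) f(2) by (rule finite_subset)
  have Wne: "W \<noteq> {}" using b X by (auto simp: bij_betw_def)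
  have YW: "Y \<subseteq> W" by (auto simp: Y_def)
  then have finY: "finite Y" using finW by (rule finite_subset)
  have pg: "perm_action W g" unfolding g_def by (rule perm_action_transport[OF b f(1)])
  have gW: "g s y \<in> W \<longleftrightarrow> y \<in> W" for s y using perm_actionD(2)[OF pg] .
  have sg: "satisfies E W g" unfolding g_def by (rule satisfies_transport[OF b f(1,3)])
  have og: "orbit g x = W" if x: "x \<in> W" for x
  proof
    show "orbit g x \<subseteq> W" using orbit_subset[OF pg x] .
    show "W \<subseteq> orbit g x"
    proof
      fix y assume y: "y \<in> W"
      have "b x \<in> V" "b y \<in> V" using b x y by (auto simp: bij_betw_def)
      then have "b y \<in> orbit f (b x)" using f(4) by simp
      then obtain w where "wact f w (b x) = b y" by (auto simp: orbit_def)
      then have "wact g w x = y"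
        unfolding g_def using wact_transport_eq_iff[OF b f(1) x y] by simp
      then show "y \<in> orbit g x" by (auto simp: orbit_def)
    qed
  qed
  have G: "graph_of W g \<in> finite_connected_GSol E"
    unfolding finite_connected_GSol_def
    using graph_of_GSol_iff[OF pg Wne] sg connected_graph_of_iff[OF pg] og finW by simp
  have bg: "b (g s y) = f s (b y)" if "y \<in> W" for s y
    using wact_transport[OF b f(1) that, of "[Pos s]"] by (simp add: g_def)
  have injb: "inj_on b W" using b by (simp add: bij_betw_def)
  have image: "b ` {y\<in>Y. Q (b y)} = {x\<in>X. Q x}" for Q
    using b X(1) by (fastforce simp: Y_def bij_betw_def)
  have cardX: "card Y = card X"
    using image[of "\<lambda>_. True"] card_image[OF inj_on_subset[OF injb YW]] by simp
  have out: "card {y\<in>Y. g s y \<notin> Y} = card {x\<in>X. f s x \<notin> X}" for s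
  proof -
    have "{y\<in>Y. g s y \<notin> Y} = {y\<in>Y. f s (b y) \<notin> X}"
      using YW by (auto simp: Y_def bg gW)
    moreover have "card (b ` {y\<in>Y. f s (b y) \<notin> X}) = card {y\<in>Y. f s (b y) \<notin> X}"
      by (rule card_image[OF inj_on_subset[OF injb]]) (use YW in auto)
    ultimately show ?thesis using image[of "\<lambda>x. f s x \<notin> X"] by simp
  qed
  have inn: "card {y\<in>W - Y. g s y \<in> Y} = card {y\<in>Y. g s y \<notin> Y}" for s
  proof -
    \<comment> \<open>\<open>P\<close> is the preimage of \<open>Y\<close> and has the same size, so
      \<open>P - Y\<close> and \<open>Y - P\<close> are equinumerous.\<close>
    define P where "P = {y\<in>W. g s y \<in> Y}"
    have "g s ` P = Y"
    proof
      show "Y \<subseteq> g s ` P"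
      proof
        fix y assume "y \<in> Y"
        then have "inv (g s) y \<in> P"
          using YW perm_actionD(3,5)[OF pg] by (auto simp: P_def)
        then show "y \<in> g s ` P" using perm_actionD(3)[OF pg, of s y] by (metis imageI)
      qed
    qed (auto simp: P_def)
    moreover have "inj_on (g s) P"
      using perm_actionD(1)[OF pg] by (meson bij_is_inj inj_on_subset subset_UNIV)
    ultimately have "card P = card Y" using card_image by metis
    moreover have "card (P - Y) = card P - card (P \<inter> Y)" "card (Y - P) = card Y - card (Y \<inter> P)"
      using finY by (simp_all add: card_Diff_subset_Int)
    ultimately have "card (P - Y) = card (Y - P)" by (simp add: Int_commute)
    moreover have "P - Y = {y\<in>W - Y. g s y \<in> Y}" "Y - P = {y\<in>Y. g s y \<notin> Y}"
      using YW by (auto simp: P_def)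
    ultimately show ?thesis by simp
  qed
  let ?B = "\<lambda>s. {y\<in>Y. g s y \<notin> Y} \<union> {y\<in>W - Y. g s y \<in> Y}"
  have "edges_between (graph_of W g) Y (W - Y) \<subseteq> (\<Union>s\<in>UNIV. (\<lambda>y. (y, s, g s y)) ` ?B s)"
    unfolding edges_between_def by (auto simp: edges_graph_of)
  moreover have finB: "finite (?B s)" for s
    using finY finW by simp
  ultimately have "card (edges_between (graph_of W g) Y (W - Y))
      \<le> card (\<Union>s\<in>UNIV. (\<lambda>y. (y, s, g s y)) ` ?B s)"
    by (intro card_mono) auto
  also have "\<dots> \<le> (\<Sum>s\<in>UNIV. card ((\<lambda>y. (y, s, g s y)) ` ?B s))"
    by (rule card_UN_le) simp
  also have "\<dots> \<le> (\<Sum>s\<in>UNIV. 2 * card {x\<in>X. f s x \<notin> X})"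
  proof (rule sum_mono)
    fix s
    have "card ((\<lambda>y. (y, s, g s y)) ` ?B s) \<le> card (?B s)"
      using finB by (rule card_image_le)
    also have "\<dots> \<le> card {y\<in>Y. g s y \<notin> Y} + card {y\<in>W - Y. g s y \<in> Y}"
      by (rule card_Un_le)
    finally show "card ((\<lambda>y. (y, s, g s y)) ` ?B s) \<le> 2 * card {x\<in>X. f s x \<notin> X}"
      using inn out by simp
  qed
  also have "\<dots> = 2 * (\<Sum>s\<in>UNIV. card {x\<in>X. f s x \<notin> X})"
    by (simp add: sum_distrib_left)
  finally have "real (card (edges_between (graph_of W g) Y (W - Y)))
      \<le> real (2 * (\<Sum>s\<in>UNIV. card {x\<in>X. f s x \<notin> X}))"
    by (rule of_nat_mono)
  then have edges: "real (card (edges_between (graph_of W g) Y (W - Y)))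
      \<le> 2 * (\<Sum>s\<in>UNIV. real (card {x\<in>X. f s x \<notin> X}))"
    by simp
  have pos: "card Y > 0" using cardX X(2) finX by (simp add: card_gt_0_iff)
  have "cheeger (graph_of W g)
      \<le> ereal (real (card (edges_between (graph_of W g) Y (W - Y))) / real (card Y))"
    unfolding cheeger_def
  proof (rule Inf_lower, intro CollectI exI conjI)
    show "real (card Y) \<le> real (card (vertices (graph_of W g))) / 2"
      using X(3) cardX by (simp add: W_def)
  qed (use YW pos in auto)
  with c[OF G] have "ereal c \<le> ereal (real (card (edges_between (graph_of W g) Y (W - Y))) / real (card Y))"
    by (rule order_trans)
  then have "c * card Y \<le> card (edges_between (graph_of W g) Y (W - Y))"
    using pos by (simp add: field_simps)
  with edges cardX show ?thesis by simp
qed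

text \<open>Each orbit is a finite connected solution, so the bound holds for the part of
  \<open>D\<close> in it. Orbits are invariant: cutting \<open>D\<close> along them creates no new
  boundary, and both sides add up.\<close>

lemma boundary_ge:
  fixes f :: "'s::finite \<Rightarrow> 'v \<Rightarrow> 'v"
  assumes f: "perm_action Z f" "finite Z" "satisfies E Z f"
    and c: "\<And>G. G \<in> finite_connected_GSol E \<Longrightarrow> ereal c \<le> cheeger G"
    and D: "D \<subseteq> Z" "\<And>x. x \<in> D \<Longrightarrow> 2 * card (D \<inter> orbit f x) \<le> card (orbit f x)"
  shows "c * card D \<le> 2 * (\<Sum>s\<in>UNIV. real (card {x\<in>D. f s x \<notin> D}))"
proof -
  define P where "P = orbit f ` D"
  have finD: "finite D" using D(1) f(2) by (rule finite_subset)
  have finP: "finite P" using finD by (simp add: P_def)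
  have split: "card A = (\<Sum>Q\<in>P. card (A \<inter> Q))" if "A \<subseteq> D" for A
  proof -
    have "A = (\<Union>Q\<in>P. A \<inter> Q)"
      using that orbit_self[of _ f] by (auto simp: P_def)
    moreover have "card (\<Union>Q\<in>P. A \<inter> Q) = (\<Sum>Q\<in>P. card (A \<inter> Q))"
    proof (rule card_UN_disjoint[OF finP])
      show "\<forall>Q\<in>P. finite (A \<inter> Q)" using that finD finite_subset by blast
      show "\<forall>Q\<in>P. \<forall>Q'\<in>P. Q \<noteq> Q' \<longrightarrow> (A \<inter> Q) \<inter> (A \<inter> Q') = {}"
        unfolding P_def using orbit_eq[OF f(1)] by blast
    qed
    ultimately show ?thesis by simp
  qed
  have "c * card (D \<inter> Q) \<le> 2 * (\<Sum>s\<in>UNIV. real (card ({x\<in>D. f s x \<notin> D} \<inter> Q)))"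
    if QP: "Q \<in> P" for Q
  proof -
    obtain x where x: "x \<in> D" "Q = orbit f x" using QP by (auto simp: P_def)
    have QZ: "Q \<subseteq> Z" using x D(1) orbit_subset[OF f(1)] by blast
    have closed: "lact f l y \<in> Q" if y: "y \<in> Q" for l y
    proof -
      obtain w where "y = wact f w x" using y x(2) by (auto simp: orbit_def)
      then have "lact f l y = wact f (l # w) x" by simp
      then show ?thesis using x(2) unfolding orbit_def by blast
    qed
    have "perm_action Q f"
      unfolding perm_action_def
    proof (intro allI conjI)
      fix s
      show "bij (f s)" using perm_actionD(1)[OF f(1)] .
      show "f s ` Q = Q"
      proof
        show "f s ` Q \<subseteq> Q" using closed[of _ "Pos s"] by auto
        show "Q \<subseteq> f s ` Q"
        proof
          fix y assume "y \<in> Q"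
          then have "inv (f s) y \<in> Q" using closed[of _ "Neg s"] by simp
          then show "y \<in> f s ` Q" using perm_actionD(3)[OF f(1), of s y] by (metis imageI)
        qed
      qed
    qed
    moreover have "finite Q" using QZ f(2) by (rule finite_subset)
    moreover have "satisfies E Q f" using f(3) QZ by (fastforce simp: satisfies_def)
    moreover have "orbit f y = Q" if "y \<in> Q" for y
      using orbit_eq[OF f(1)] that x(2) by simp
    moreover have "D \<inter> Q \<noteq> {}" using x orbit_self[of x f] by blast
    ultimately have "c * card (D \<inter> Q)
        \<le> 2 * (\<Sum>s\<in>UNIV. real (card {x\<in>D \<inter> Q. f s x \<notin> D \<inter> Q}))"
      using D(2)[OF x(1)] x(2) by (intro cheeger_boundary[OF _ _ _ _ c]) auto
    moreover have "{x\<in>D \<inter> Q. f s x \<notin> D \<inter> Q} = {x\<in>D. f s x \<notin> D} \<inter> Q" for s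
      using closed[of _ "Pos s"] by auto
    ultimately show ?thesis by simp
  qed
  then have "(\<Sum>Q\<in>P. c * card (D \<inter> Q))
      \<le> (\<Sum>Q\<in>P. 2 * (\<Sum>s\<in>UNIV. real (card ({x\<in>D. f s x \<notin> D} \<inter> Q))))"
    by (rule sum_mono)
  moreover have "(\<Sum>Q\<in>P. c * card (D \<inter> Q)) = c * card D"
    using split[of D] by (simp add: sum_distrib_left)
  moreover have "(\<Sum>Q\<in>P. 2 * (\<Sum>s\<in>UNIV. real (card ({x\<in>D. f s x \<notin> D} \<inter> Q))))
      = 2 * (\<Sum>s\<in>UNIV. \<Sum>Q\<in>P. real (card ({x\<in>D. f s x \<notin> D} \<inter> Q)))"
    by (subst sum.swap) (simp add: sum_distrib_left)
  moreover have "(\<Sum>Q\<in>P. real (card ({x\<in>D. f s x \<notin> D} \<inter> Q))) = card {x\<in>D. f s x \<notin> D}" for s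
    using split[of "{x\<in>D. f s x \<notin> D}"] by simp
  ultimately show ?thesis by simp
qed

section \<open>Products of actions\<close>

lemma perm_action_product:
  assumes "perm_action V h" "perm_action W g"
  shows "perm_action (V \<times> W) (\<lambda>s. map_prod (h s) (g s))"
  unfolding perm_action_def
proof (intro allI conjI)
  fix s
  show "bij (map_prod (h s) (g s))"
    using perm_actionD(1)[OF assms(1), of s] perm_actionD(1)[OF assms(2), of s]
    by (simp add: bij_def prod.inj_map map_prod_surj)
  show "map_prod (h s) (g s) ` (V \<times> W) = V \<times> W"
    using assms by (simp add: map_prod_surj_on perm_action_def)
qed

lemma wact_product:
  assumes "perm_action V h" "perm_action W g"
  shows "wact (\<lambda>s. map_prod (h s) (g s)) w (x, y) = (wact h w x, wact g w y)"
proof -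
  have "lact (\<lambda>s. map_prod (h s) (g s)) l (x, y) = (lact h l x, lact g l y)" for l x y
  proof (cases l)
    case (Neg s)
    have "inj (map_prod (h s) (g s))"
      using perm_actionD(1)[OF perm_action_product[OF assms]] by (rule bij_is_inj)
    then have "inv (map_prod (h s) (g s)) (x, y) = (inv (h s) x, inv (g s) y)"
      by (rule inv_f_eq) (simp add: perm_actionD(3)[OF assms(1)] perm_actionD(3)[OF assms(2)])
    with Neg show ?thesis by simp
  qed simp
  then show ?thesis by (induction w) simp_all
qed

text \<open>Here \<open>D\<close> is the graph of \<open>p\<close> as a subset of the product. An orbit with two or more points
  over each vertex of \<open>W\<close> that it meets is at most half filled by \<open>D\<close>, and an orbit with only one
  is excluded by \<open>card W < card V\<close>.\<close>

lemma defect_ge: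
  fixes g :: "'s::finite \<Rightarrow> 'w \<Rightarrow> 'w" and h :: "'s \<Rightarrow> 'v \<Rightarrow> 'v"
  assumes h: "perm_action V h" "finite V" "satisfies E V h" "\<And>x. x \<in> V \<Longrightarrow> orbit h x = V"
    and g: "perm_action W g" "finite W" "satisfies E W g"
    and c: "\<And>G. G \<in> finite_connected_GSol E \<Longrightarrow> ereal c \<le> cheeger G"
    and less: "card W < card V"
    and p: "p ` W \<subseteq> V"
  shows "c * card W \<le> 2 * (\<Sum>s\<in>UNIV. real (card {x\<in>W. p (g s x) \<noteq> h s (p x)}))"
proof -
  define F where "F = (\<lambda>s. map_prod (h s) (g s))"
  define D where "D = (\<lambda>x. (p x, x)) ` W"
  have F: "perm_action (V \<times> W) F"
    unfolding F_def by (rule perm_action_product[OF h(1) g(1)])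
  have wF: "wact F w (x, y) = (wact h w x, wact g w y)" for w x y
    unfolding F_def by (rule wact_product[OF h(1) g(1)])
  have inj: "inj_on (\<lambda>x. (p x, x)) A" for A by (auto intro: inj_onI)
  have cardD: "card D = card W" by (simp add: D_def card_image inj)
  have "c * card D \<le> 2 * (\<Sum>s\<in>UNIV. real (card {z\<in>D. F s z \<notin> D}))"
  proof (rule boundary_ge[OF F _ _ c])
    show "finite (V \<times> W)" using h(2) g(2) by simp
    show "satisfies E (V \<times> W) F"
      using h(3) g(3) by (fastforce simp: satisfies_def wF)
    show "D \<subseteq> V \<times> W" using p by (auto simp: D_def)
    fix z assume "z \<in> D"
    then obtain x where x: "x \<in> W" "z = (p x, x)" by (auto simp: D_def)
    then have px: "p x \<in> V" using p by auto
    define Q where "Q = orbit F z"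
    define Y where "Y = orbit g x"
    \<comment> \<open>The size of the fibre of \<open>Q\<close> over \<open>y\<close>. A word
      carries fibres injectively into fibres, and so does its inverse, which makes \<open>k\<close>
      constant on the orbit \<open>Y\<close>.\<close>
    define k where "k = (\<lambda>y. card {z\<in>Q. snd z = y})"
    have QVW: "Q \<subseteq> V \<times> W" unfolding Q_def
      using orbit_subset[OF F] x px by simp
    have finQ: "finite Q" using QVW h(2) g(2) by (meson finite_SigmaI finite_subset)
    have Q: "Q = {(wact h w (p x), wact g w x) |w. True}"
      by (simp add: Q_def orbit_def x wF)
    have sndQ: "snd ` Q = Y" by (force simp: Q Y_def orbit_def)
    have "fst ` Q = orbit h (p x)" by (force simp: Q orbit_def)
    then have fstQ: "fst ` Q = V" using h(4) px by simp
    have k_le: "k y \<le> k (wact g w y)" for y w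
      unfolding k_def
    proof (rule card_inj_on_le)
      show "inj_on (wact F w) {z\<in>Q. snd z = y}"
        using wact_word_inv[OF F, of w] by (metis inj_on_inverseI)
      show "wact F w ` {z\<in>Q. snd z = y} \<subseteq> {z\<in>Q. snd z = wact g w y}"
        by (auto simp: Q wF simp flip: wact_append)
      show "finite {z\<in>Q. snd z = wact g w y}" using finQ by simp
    qed
    have k_eq: "k y = k x" if yY: "y \<in> Y" for y
    proof -
      obtain w where y: "y = wact g w x" using yY by (auto simp: Y_def orbit_def)
      then have "wact g (word_inv w) y = x" using wact_word_inv[OF g(1)] by simp
      with k_le[of x w] k_le[of y "word_inv w"] y show ?thesis by simp
    qed
    have "card Q = (\<Sum>y\<in>snd ` Q. k y)"
      using sum.image_gen[OF finQ, of "\<lambda>_. 1::nat" snd] by (simp add: k_def)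
    then have cardQ: "card Q = k x * card Y" using sndQ k_eq by simp
    have YW: "card Y \<le> card W" unfolding Y_def
      using orbit_subset[OF g(1) x(1)] g(2) by (rule card_mono[rotated])
    have "card V \<le> card Q" using fstQ card_image_le[OF finQ, of fst] by simp
    have "\<not> k x \<le> 1"
    proof
      assume "k x \<le> 1"
      then have "k x * card Y \<le> 1 * card Y" by (rule mult_le_mono1)
      then show False using \<open>card V \<le> card Q\<close> cardQ YW less by linarith
    qed
    then have "2 * card Y \<le> card Q" using cardQ by simp
    moreover have "card (D \<inter> Q) \<le> card Y"
    proof (rule card_inj_on_le)
      show "inj_on snd (D \<inter> Q)" by (auto simp: D_def intro!: inj_onI)
      show "snd ` (D \<inter> Q) \<subseteq> Y" using sndQ by blast
      show "finite Y" using finQ sndQ by blast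
    qed
    ultimately show "2 * card (D \<inter> orbit F z) \<le> card (orbit F z)" by (simp add: Q_def)
  qed
  \<comment> \<open>A point \<open>(p x, x)\<close> can leave \<open>D\<close> only where
    \<open>p\<close> fails to commute with the letter \<open>s\<close>, so the boundary of
    \<open>D\<close> is bounded by the defect of \<open>p\<close>.\<close>
  moreover have "card {z\<in>D. F s z \<notin> D} \<le> card {x\<in>W. p (g s x) \<noteq> h s (p x)}" for s
  proof (rule surj_card_le)
    show "{z\<in>D. F s z \<notin> D} \<subseteq> (\<lambda>x. (p x, x)) ` {x\<in>W. p (g s x) \<noteq> h s (p x)}"
    proof
      fix z assume "z \<in> {z\<in>D. F s z \<notin> D}"
      then obtain x where x: "x \<in> W" "z = (p x, x)" and F: "(h s (p x), g s x) \<notin> D"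
        by (auto simp: D_def F_def)
      have "g s x \<in> W" using perm_actionD(2)[OF g(1)] x(1) by simp
      then have "(p (g s x), g s x) \<in> D" by (simp add: D_def)
      then have "p (g s x) \<noteq> h s (p x)" using F by auto
      with x show "z \<in> (\<lambda>x. (p x, x)) ` {x\<in>W. p (g s x) \<noteq> h s (p x)}" by blast
    qed
    show "finite {x\<in>W. p (g s x) \<noteq> h s (p x)}" using g(2) by simp
  qed
  then have "(\<Sum>s\<in>UNIV. real (card {z\<in>D. F s z \<notin> D}))
      \<le> (\<Sum>s\<in>UNIV. real (card {x\<in>W. p (g s x) \<noteq> h s (p x)}))"
    by (intro sum_mono) simp
  ultimately show ?thesis by (simp add: cardD)
qed

section \<open>Random relabellings and decision trees\<close>

text \<open>Used for two purposes: counting the relabellings compatible with what a tree has seen,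
  and repairing a truncated action.\<close>

lemma permutes_extend:
  assumes "finite W" "X \<subseteq> W" "inj_on \<sigma> X" "\<sigma> ` X \<subseteq> W"
  obtains \<rho> where "\<rho> permutes W" "\<And>a. a \<in> X \<Longrightarrow> \<rho> a = \<sigma> a"
proof -
  have "card (W - X) = card (W - \<sigma> ` X)"
    using assms by (simp add: card_Diff_subset card_image finite_subset)
  then obtain \<tau> where \<tau>: "bij_betw \<tau> (W - X) (W - \<sigma> ` X)"
    using assms(1) finite_same_card_bij[of "W - X" "W - \<sigma> ` X"] by auto
  define \<rho> where "\<rho> = (\<lambda>a. if a \<in> X then \<sigma> a else if a \<in> W then \<tau> a else a)"
  have "bij_betw \<rho> X (\<sigma> ` X)"
    using assms(3) by (subst bij_betw_cong[of X _ \<sigma>]) (auto simp: \<rho>_def bij_betw_def)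
  moreover have "bij_betw \<rho> (W - X) (W - \<sigma> ` X)"
    using \<tau> by (subst bij_betw_cong[of _ _ \<tau>]) (auto simp: \<rho>_def)
  ultimately have "bij_betw \<rho> (X \<union> (W - X)) (\<sigma> ` X \<union> (W - \<sigma> ` X))"
    by (rule bij_betw_combine) auto
  moreover have "X \<union> (W - X) = W" "\<sigma> ` X \<union> (W - \<sigma> ` X) = W" using assms by auto
  ultimately have "bij_betw \<rho> W W" by simp
  then have "\<rho> permutes W"
    by (rule bij_imp_permutes) (use assms(2) in \<open>auto simp: \<rho>_def\<close>)
  then show ?thesis by (rule that) (simp add: \<rho>_def)
qed

text \<open>\<open>\<pi>\<close> sends a name to the vertex it denotes. This is what is left of the
  sample space of a uniform relabelling once the names in \<open>X\<close> are known to denote the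
  vertices given by \<open>\<sigma>\<close>.\<close>

definition extensions :: "'v set \<Rightarrow> 'v set \<Rightarrow> ('v \<Rightarrow> 'v) \<Rightarrow> ('v \<Rightarrow> 'v) set" where
  "extensions W X \<sigma> = {\<pi>. \<pi> permutes W \<and> (\<forall>a\<in>X. \<pi> a = \<sigma> a)}"

lemma finite_extensions [simp]: "finite W \<Longrightarrow> finite (extensions W X \<sigma>)"
  unfolding extensions_def by (rule finite_subset[OF _ finite_permutations]) auto

text \<open>The extensions form a coset: one extension \<open>\<rho>\<close> composed with all
  permutations of \<open>W - X\<close>.\<close>

lemma card_extensions:
  assumes "finite W" "X \<subseteq> W" "inj_on \<sigma> X" "\<sigma> ` X \<subseteq> W"
  shows "card (extensions W X \<sigma>) = fact (card W - card X)"
proof -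
  obtain \<rho> where \<rho>: "\<rho> permutes W" "\<And>a. a \<in> X \<Longrightarrow> \<rho> a = \<sigma> a"
    using permutes_extend[OF assms] by blast
  have inj: "inj \<rho>" using \<rho>(1) by (rule permutes_inj)
  have "extensions W X \<sigma> = (\<lambda>\<tau>. \<rho> \<circ> \<tau>) ` {\<tau>. \<tau> permutes (W - X)}"
  proof
    show "extensions W X \<sigma> \<subseteq> (\<lambda>\<tau>. \<rho> \<circ> \<tau>) ` {\<tau>. \<tau> permutes (W - X)}"
    proof
      fix \<pi> assume \<pi>: "\<pi> \<in> extensions W X \<sigma>"
      define \<tau> where "\<tau> = inv \<rho> \<circ> \<pi>"
      have "\<tau> permutes W" using \<pi> \<rho>(1)
        by (simp add: \<tau>_def extensions_def permutes_compose permutes_inv)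
      moreover have "\<tau> a = a" if "a \<in> X" for a
      proof -
        have "\<pi> a = \<rho> a" using \<pi> \<rho>(2)[OF that] that by (simp add: extensions_def)
        then show ?thesis by (simp add: \<tau>_def inv_f_f[OF inj])
      qed
      ultimately have "\<tau> permutes (W - X)" by (auto intro: permutes_superset)
      moreover have "\<pi> = \<rho> \<circ> \<tau>"
        using permutes_inverses(1)[OF \<rho>(1)] by (auto simp: \<tau>_def)
      ultimately show "\<pi> \<in> (\<lambda>\<tau>. \<rho> \<circ> \<tau>) ` {\<tau>. \<tau> permutes (W - X)}" by blast
    qed
    show "(\<lambda>\<tau>. \<rho> \<circ> \<tau>) ` {\<tau>. \<tau> permutes (W - X)} \<subseteq> extensions W X \<sigma>"
    proof
      fix \<pi> assume "\<pi> \<in> (\<lambda>\<tau>. \<rho> \<circ> \<tau>) ` {\<tau>. \<tau> permutes (W - X)}"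
      then obtain \<tau> where \<tau>: "\<tau> permutes (W - X)" "\<pi> = \<rho> \<circ> \<tau>" by blast
      have "\<tau> permutes W" using \<tau>(1) by (rule permutes_subset) auto
      then have "\<pi> permutes W" using \<tau>(2) \<rho>(1) by (simp add: permutes_compose)
      moreover have "\<pi> a = \<sigma> a" if "a \<in> X" for a
        using permutes_not_in[OF \<tau>(1), of a] that \<rho>(2) \<tau>(2) by simp
      ultimately show "\<pi> \<in> extensions W X \<sigma>" by (simp add: extensions_def)
    qed
  qed
  moreover have "inj_on (\<lambda>\<tau>. \<rho> \<circ> \<tau>) {\<tau>. \<tau> permutes (W - X)}"
    using inj by (auto intro!: inj_onI ext simp: fun_eq_iff inj_eq)
  ultimately have "card (extensions W X \<sigma>) = card {\<tau>. \<tau> permutes (W - X)}"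
    by (simp add: card_image)
  also have "\<dots> = fact (card W - card X)"
    using card_permutations[OF card_Diff_subset[OF _ assms(2)]] assms
    by (simp add: finite_subset)
  finally show ?thesis .
qed

text \<open>Conditioning on the vertex denoted by a new name \<open>a\<close>, as when the tree asks
  about a name that it has not seen.\<close>

lemma card_extensions_by_label:
  assumes "finite W" "a \<in> W - X"
  shows "card {\<pi>\<in>extensions W X \<sigma>. P \<pi>}
    = (\<Sum>v\<in>W - \<sigma> ` X. card {\<pi>\<in>extensions W (insert a X) (\<sigma>(a := v)). P \<pi>})"
proof -
  let ?A = "\<lambda>v. {\<pi>\<in>extensions W (insert a X) (\<sigma>(a := v)). P \<pi>}"
  have "{\<pi>\<in>extensions W X \<sigma>. P \<pi>} = (\<Union>v\<in>W - \<sigma> ` X. ?A v)"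
  proof
    show "{\<pi>\<in>extensions W X \<sigma>. P \<pi>} \<subseteq> (\<Union>v\<in>W - \<sigma> ` X. ?A v)"
    proof
      fix \<pi> assume \<pi>: "\<pi> \<in> {\<pi>\<in>extensions W X \<sigma>. P \<pi>}"
      then have perm: "\<pi> permutes W" and ext: "\<And>x. x \<in> X \<Longrightarrow> \<pi> x = \<sigma> x"
        by (auto simp: extensions_def)
      have "\<pi> a \<in> W" using perm assms(2) by (simp add: permutes_in_image)
      moreover have "\<pi> a \<notin> \<sigma> ` X"
      proof
        assume "\<pi> a \<in> \<sigma> ` X"
        then obtain x where "x \<in> X" "\<pi> a = \<pi> x" using ext by auto
        then show False using permutes_inj[OF perm] assms(2) by (auto dest: injD)
      qed
      moreover have "\<pi> \<in> ?A (\<pi> a)" using \<pi> by (auto simp: extensions_def)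
      ultimately show "\<pi> \<in> (\<Union>v\<in>W - \<sigma> ` X. ?A v)" by blast
    qed
    show "(\<Union>v\<in>W - \<sigma> ` X. ?A v) \<subseteq> {\<pi>\<in>extensions W X \<sigma>. P \<pi>}"
      using assms(2) by (auto simp: extensions_def split: if_splits)
  qed
  also have "card \<dots> = (\<Sum>v\<in>W - \<sigma> ` X. card (?A v))"
  proof (rule card_UN_disjoint)
    show "\<forall>v\<in>W - \<sigma> ` X. \<forall>v'\<in>W - \<sigma> ` X. v \<noteq> v' \<longrightarrow> ?A v \<inter> ?A v' = {}"
      by (auto simp: extensions_def)
  qed (use assms(1) in auto)
  finally show ?thesis .
qed

text \<open>Conditioning on the name of a new vertex \<open>y\<close>, as when the answer to a query
  is a vertex not revealed before.\<close>

lemma card_extensions_by_vertex: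
  assumes "finite W" "X \<subseteq> W" "y \<in> W - \<sigma> ` X"
  shows "card {\<pi>\<in>extensions W X \<sigma>. P \<pi>}
    = (\<Sum>b\<in>W - X. card {\<pi>\<in>extensions W (insert b X) (\<sigma>(b := y)). P \<pi>})"
proof -
  let ?A = "\<lambda>b. {\<pi>\<in>extensions W (insert b X) (\<sigma>(b := y)). P \<pi>}"
  have "{\<pi>\<in>extensions W X \<sigma>. P \<pi>} = (\<Union>b\<in>W - X. ?A b)"
  proof
    show "{\<pi>\<in>extensions W X \<sigma>. P \<pi>} \<subseteq> (\<Union>b\<in>W - X. ?A b)"
    proof
      fix \<pi> assume \<pi>: "\<pi> \<in> {\<pi>\<in>extensions W X \<sigma>. P \<pi>}"
      then have perm: "\<pi> permutes W" and ext: "\<And>x. x \<in> X \<Longrightarrow> \<pi> x = \<sigma> x"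
        by (auto simp: extensions_def)
      obtain b where b: "b \<in> W" "\<pi> b = y"
        using permutes_image[OF perm] assms(3) by (metis DiffD1 imageE)
      moreover have "b \<notin> X" using ext b assms(3) by auto
      moreover have "\<pi> \<in> ?A b" using \<pi> b by (auto simp: extensions_def)
      ultimately show "\<pi> \<in> (\<Union>b\<in>W - X. ?A b)" by blast
    qed
    show "(\<Union>b\<in>W - X. ?A b) \<subseteq> {\<pi>\<in>extensions W X \<sigma>. P \<pi>}"
      by (auto simp: extensions_def split: if_splits)
  qed
  also have "card \<dots> = (\<Sum>b\<in>W - X. card (?A b))"
  proof (rule card_UN_disjoint)
    show "\<forall>b\<in>W - X. \<forall>b'\<in>W - X. b \<noteq> b' \<longrightarrow> ?A b \<inter> ?A b' = {}"
      by (auto simp: extensions_def dest!: permutes_inj injD)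
  qed (use assms(1) in auto)
  finally show ?thesis .
qed

section \<open>Relabelled actions\<close>

definition relabel :: "('v \<Rightarrow> 'v) \<Rightarrow> ('s \<Rightarrow> 'v \<Rightarrow> 'v) \<Rightarrow> 's \<Rightarrow> 'v \<Rightarrow> 'v" where
  "relabel \<pi> f s = inv \<pi> \<circ> f s \<circ> \<pi>"

lemma perm_action_relabel:
  assumes "\<pi> permutes W" "perm_action W f"
  shows "perm_action W (relabel \<pi> f)"
proof -
  have "bij \<pi>" "bij (inv \<pi>)" "\<pi> ` W = W" "inv \<pi> ` W = W"
    using assms(1) permutes_inv[OF assms(1)] by (auto simp: permutes_image intro: permutes_bij)
  then have "bij (relabel \<pi> f s)" "relabel \<pi> f s ` W = W" for s
    using assms(2) unfolding perm_action_def relabel_def by (simp_all only: bij_comp image_comp[symmetric])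
  then show ?thesis by (simp add: perm_action_def)
qed

lemma lact_relabel:
  assumes "\<pi> permutes W" "perm_action W f"
  shows "lact (relabel \<pi> f) l x = inv \<pi> (lact f l (\<pi> x))"
proof (cases l)
  case (Neg s)
  have "inj (relabel \<pi> f s)"
    using perm_actionD(1)[OF perm_action_relabel[OF assms]] by (rule bij_is_inj)
  then have "inv (relabel \<pi> f s) x = inv \<pi> (inv (f s) (\<pi> x))"
    by (rule inv_f_eq)
      (simp add: relabel_def permutes_inverses[OF assms(1)] perm_actionD(3)[OF assms(2)])
  with Neg show ?thesis by simp
qed (simp add: relabel_def)

lemma wact_relabel:
  assumes "\<pi> permutes W" "perm_action W f"
  shows "wact (relabel \<pi> f) w x = inv \<pi> (wact f w (\<pi> x))"
  by (induction w) (simp_all add: lact_relabel[OF assms] permutes_inverses[OF assms(1)])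

lemma satisfies_relabel:
  assumes "\<pi> permutes W" "perm_action W f" "satisfies E W f"
  shows "satisfies E W (relabel \<pi> f)"
  unfolding satisfies_def
proof clarify
  fix w1 w2 x assume "(w1, w2) \<in> E" "x \<in> W"
  then have "wact f w1 (\<pi> x) = wact f w2 (\<pi> x)"
    using assms(3) permutes_in_image[OF assms(1)] by (auto simp: satisfies_def)
  then show "wact (relabel \<pi> f) w1 x = wact (relabel \<pi> f) w2 x"
    by (simp add: wact_relabel[OF assms(1,2)])
qed

section \<open>Local types and patterns of revealed vertices\<close>

definition words :: "nat \<Rightarrow> 's sword set" where
  "words d = {u. length u \<le> d}"

lemma finite_letters: "finite (UNIV :: 's::finite letter set)"
proof -
  have "l \<in> range Pos \<union> range Neg" for l :: "'s letter" by (cases l) auto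
  then have "(UNIV :: 's letter set) \<subseteq> range Pos \<union> range Neg" by blast
  then show ?thesis by (rule finite_subset) simp
qed

lemma finite_words [simp]: "finite (words d :: 's::finite sword set)"
  using finite_lists_length_le[OF finite_letters, of d] by (simp add: words_def)

text \<open>This encodes the shape of a ball around \<open>v\<close>: two words lead from
  \<open>v\<close> to the same vertex exactly when one followed by the inverse of the other fixes
  \<open>v\<close>. Over a finite alphabet it takes finitely many values.\<close>

definition local_type :: "nat \<Rightarrow> ('s \<Rightarrow> 'v \<Rightarrow> 'v) \<Rightarrow> 'v \<Rightarrow> 's sword set" where
  "local_type d f v = {u \<in> words d. wact f u v = v}"

text \<open>This is the invariant of the comparison of two runs of a decision tree: the labels in \<open>X\<close>
  have been revealed to be the vertices \<open>\<sigma> a\<close> in one graph and \<open>\<sigma>' a\<close> in the other one, and both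
  configurations look the same up to distance \<open>d\<close>. Each query costs two units of \<open>d\<close>.\<close>

definition same_pattern :: "nat \<Rightarrow> 'a set \<Rightarrow> ('s \<Rightarrow> 'v \<Rightarrow> 'v) \<Rightarrow> ('s \<Rightarrow> 'w \<Rightarrow> 'w) \<Rightarrow>
    ('a \<Rightarrow> 'v) \<Rightarrow> ('a \<Rightarrow> 'w) \<Rightarrow> bool" where
  "same_pattern d X f f' \<sigma> \<sigma>' \<longleftrightarrow>
     (\<forall>a\<in>X. \<forall>b\<in>X. \<forall>u\<in>words d. wact f u (\<sigma> a) = \<sigma> b \<longleftrightarrow> wact f' u (\<sigma>' a) = \<sigma>' b)"

lemma same_patternD:
  "same_pattern d X f f' \<sigma> \<sigma>' \<Longrightarrow> a \<in> X \<Longrightarrow> b \<in> X \<Longrightarrow> length u \<le> d \<Longrightarrow>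
    wact f u (\<sigma> a) = \<sigma> b \<longleftrightarrow> wact f' u (\<sigma>' a) = \<sigma>' b"
  by (simp add: same_pattern_def words_def)

lemma same_pattern_mono:
  "same_pattern d X f f' \<sigma> \<sigma>' \<Longrightarrow> d' \<le> d \<Longrightarrow> same_pattern d' X f f' \<sigma> \<sigma>'"
  by (auto simp: same_pattern_def words_def)

lemma wact_eq_lact_iff:
  assumes "perm_action W f"
  shows "wact f u x = lact f l y \<longleftrightarrow> wact f (letter_inv l # u) x = y"
  using lact_eq_iff[OF assms, of "wact f u x" l y] by simp

text \<open>A word starting at the new point becomes one starting at \<open>a\<close> by appending
  \<open>l\<close>; a word ending there becomes one ending at \<open>a\<close> by putting the
  inverse of \<open>l\<close> in front. Both may happen at once, hence the loss of two.\<close>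

lemma same_pattern_insert_neighbour:
  fixes f :: "'s \<Rightarrow> 'v \<Rightarrow> 'v" and f' :: "'s \<Rightarrow> 'w \<Rightarrow> 'w"
  assumes f: "perm_action W f" "perm_action W' f'"
    and pat: "same_pattern (Suc (Suc d)) X f f' \<sigma> \<sigma>'"
    and ab: "a \<in> X" "b \<notin> X"
  shows "same_pattern d (insert b X) f f' (\<sigma>(b := lact f l (\<sigma> a))) (\<sigma>'(b := lact f' l (\<sigma>' a)))"
  unfolding same_pattern_def
proof (intro ballI)
  fix c e and u :: "'s sword"
  assume ce: "c \<in> insert b X" "e \<in> insert b X" and "u \<in> words d"
  then have u: "length u \<le> d" by (simp add: words_def)
  note D = same_patternD[OF pat]
  let ?s = "\<sigma>(b := lact f l (\<sigma> a))" and ?s' = "\<sigma>'(b := lact f' l (\<sigma>' a))"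
  define c' where "c' = (if c = b then a else c)"
  define e' where "e' = (if e = b then a else e)"
  define u1 where "u1 = (if c = b then u @ [l] else u)"
  define u2 where "u2 = (if e = b then letter_inv l # u1 else u1)"
  have "wact f u (?s c) = wact f u1 (\<sigma> c')" "wact f' u (?s' c) = wact f' u1 (\<sigma>' c')"
    by (simp_all add: u1_def c'_def wact_append)
  moreover have "wact f u1 x = ?s e \<longleftrightarrow> wact f u2 x = \<sigma> e'" for x
    by (simp add: u2_def e'_def wact_eq_lact_iff[OF f(1)] del: wact_Cons)
  moreover have "wact f' u1 x = ?s' e \<longleftrightarrow> wact f' u2 x = \<sigma>' e'" for x
    by (simp add: u2_def e'_def wact_eq_lact_iff[OF f(2)] del: wact_Cons)
  moreover have "wact f u2 (\<sigma> c') = \<sigma> e' \<longleftrightarrow> wact f' u2 (\<sigma>' c') = \<sigma>' e'"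
    by (rule D) (use ce ab u in \<open>auto simp: c'_def e'_def u1_def u2_def\<close>)
  ultimately show "wact f u (?s c) = ?s e \<longleftrightarrow> wact f' u (?s' c) = ?s' e" by simp
qed

text \<open>The new points are out of reach of the revealed ones, so every mixed comparison is false
  on both sides. Only closed words at the new point remain, and \<open>type\<close> compares those;
  no radius is lost.\<close>

lemma same_pattern_insert_isolated:
  fixes f :: "'s \<Rightarrow> 'v \<Rightarrow> 'v" and f' :: "'s \<Rightarrow> 'w \<Rightarrow> 'w"
  assumes f: "perm_action W f" "perm_action W' f'"
    and pat: "same_pattern d X f f' \<sigma> \<sigma>'" and x: "x \<notin> X"
    and type: "local_type d f v = local_type d f' v'"
    and v: "\<And>a u. a \<in> X \<Longrightarrow> u \<in> words d \<Longrightarrow> wact f u (\<sigma> a) \<noteq> v"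
    and v': "\<And>a u. a \<in> X \<Longrightarrow> u \<in> words d \<Longrightarrow> wact f' u (\<sigma>' a) \<noteq> v'"
  shows "same_pattern d (insert x X) f f' (\<sigma>(x := v)) (\<sigma>'(x := v'))"
  unfolding same_pattern_def
proof (intro ballI)
  fix c e and u :: "'s sword"
  assume ce: "c \<in> insert x X" "e \<in> insert x X" and u: "u \<in> words d"
  have u': "word_inv u \<in> words d" using u by (simp add: words_def)
  have 1: "wact f u v \<noteq> \<sigma> a" "wact f' u v' \<noteq> \<sigma>' a" if a: "a \<in> X" for a
    using v[OF a u'] v'[OF a u'] wact_word_inv[OF f(1), of u v] wact_word_inv[OF f(2), of u v'] by auto
  have 2: "wact f u v = v \<longleftrightarrow> wact f' u v' = v'"
    using type u by (auto simp: local_type_def)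
  have 3: "wact f u (\<sigma> a) = \<sigma> b \<longleftrightarrow> wact f' u (\<sigma>' a) = \<sigma>' b" if "a \<in> X" "b \<in> X" for a b
    using same_patternD[OF pat that] u by (simp add: words_def)
  show "wact f u ((\<sigma>(x := v)) c) = (\<sigma>(x := v)) e \<longleftrightarrow> wact f' u ((\<sigma>'(x := v')) c) = (\<sigma>'(x := v')) e"
    using ce x 1 2 3 v[OF _ u] v'[OF _ u] by (cases "c = x"; cases "e = x") auto
qed

section \<open>Counting accepting relabellings\<close>

definition accepting :: "nat set \<Rightarrow> ('s \<Rightarrow> nat \<Rightarrow> nat) \<Rightarrow> 's query_tree \<Rightarrow> nat set \<Rightarrow> (nat \<Rightarrow> nat) \<Rightarrow> nat" where
  "accepting W f t X \<sigma> = card {\<pi>\<in>extensions W X \<sigma>. accepts (graph_of W (relabel \<pi> f)) t}"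

text \<open>The bound is asked only of relabellings compatible with \<open>X\<close> and
  \<open>\<sigma>\<close>; a branch of the tree that no such input reaches is unconstrained.\<close>

definition within_budget :: "nat set \<Rightarrow> ('s \<Rightarrow> nat \<Rightarrow> nat) \<Rightarrow> nat \<Rightarrow> 's query_tree \<Rightarrow> nat set \<Rightarrow> (nat \<Rightarrow> nat) \<Rightarrow> bool" where
  "within_budget W f q t X \<sigma> \<longleftrightarrow> (\<forall>\<pi>\<in>extensions W X \<sigma>.
     let qs = queries (graph_of W (relabel \<pi> f)) t in length qs \<le> q \<and> fst ` set qs \<subseteq> W)"

lemma letter_act_relabel:
  assumes "perm_action W f" "\<pi> \<in> extensions W X \<sigma>" "x \<in> X" "x \<in> W"
    and "b \<in> X" "\<sigma> b = lact f l (\<sigma> x)"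
  shows "letter_act (graph_of W (relabel \<pi> f)) l x = b"
proof -
  have \<pi>: "\<pi> permutes W" and ext: "\<And>a. a \<in> X \<Longrightarrow> \<pi> a = \<sigma> a"
    using assms(2) by (auto simp: extensions_def)
  have "letter_act (graph_of W (relabel \<pi> f)) l x = inv \<pi> (lact f l (\<pi> x))"
    using letter_act_graph_of[OF perm_action_relabel[OF \<pi> assms(1)] assms(4)]
      lact_relabel[OF \<pi> assms(1)] by simp
  also have "lact f l (\<pi> x) = \<pi> b" using assms(3,5,6) ext by simp
  finally show ?thesis using permutes_inverses(2)[OF \<pi>] by simp
qed

text \<open>All compatible relabellings are forced to give the answer \<open>b\<close>, so the query
  reveals nothing and the count does not change.\<close>

lemma accepting_known_answer:
  assumes "perm_action W f" "x \<in> X" "x \<in> W" "b \<in> X" "\<sigma> b = lact f l (\<sigma> x)"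
  shows "accepting W f (Query x l k) X \<sigma> = accepting W f (k b) X \<sigma>"
    and "within_budget W f (Suc q) (Query x l k) X \<sigma> \<Longrightarrow> within_budget W f q (k b) X \<sigma>"
proof -
  have L: "letter_act (graph_of W (relabel \<pi> f)) l x = b" if "\<pi> \<in> extensions W X \<sigma>" for \<pi>
    using assms(1) that assms(2-5) by (rule letter_act_relabel)
  show "accepting W f (Query x l k) X \<sigma> = accepting W f (k b) X \<sigma>"
    using L by (simp add: accepting_def cong: conj_cong)
  show "within_budget W f (Suc q) (Query x l k) X \<sigma> \<Longrightarrow> within_budget W f q (k b) X \<sigma>"
    using L by (simp add: within_budget_def)
qed

lemma extensions_insert_subset:
  assumes "a \<notin> X"
  shows "extensions W (insert a X) (\<sigma>(a := v)) \<subseteq> extensions W X \<sigma>"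
  using assms by (auto simp: extensions_def split: if_splits)

lemma within_budget_insert:
  assumes "a \<notin> X" "within_budget W f q t X \<sigma>"
  shows "within_budget W f q t (insert a X) (\<sigma>(a := v))"
  using assms(2) extensions_insert_subset[OF assms(1)] unfolding within_budget_def by blast

text \<open>A query of an unseen label reveals a uniformly random unused vertex \<open>v\<close>, which is paired with
  \<open>\<phi> v\<close> in the other graph. The bound \<open>\<delta>\<close> is on the probability that \<open>v\<close> has no partner or that one
  of the two lies close to a vertex that was revealed before.\<close>

lemma accepting_le:
  fixes f f' :: "'s::finite \<Rightarrow> nat \<Rightarrow> nat" and \<delta> :: real
  assumes W: "finite W" and f: "perm_action W f" "perm_action W f'"
    and \<phi>: "inj_on \<phi> M" "M \<subseteq> W" "\<phi> ` M \<subseteq> W"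
      "\<And>v. v \<in> M \<Longrightarrow> local_type (2 * Q) f v = local_type (2 * Q) f' (\<phi> v)"
    and \<delta>: "0 \<le> \<delta>" "card (W - M) + 4 * Q * card (words (2 * Q) :: 's sword set)
      \<le> \<delta> * (real (card W) - 2 * Q)"
    and budget: "within_budget W f Q t {} \<sigma>"
  shows "accepting W f t {} \<sigma> \<le> accepting W f' t {} \<sigma>' + Q * \<delta> * fact (card W)"
proof -
  define K where "K = card (words (2 * Q) :: 's sword set)"
  define conf where "conf = (\<lambda>X \<sigma>. X \<subseteq> W \<and> inj_on \<sigma> X \<and> \<sigma> ` X \<subseteq> W)"
  have conf_insert: "conf (insert a X) (\<sigma>(a := v))"
    if "conf X \<sigma>" "a \<in> W - X" "v \<in> W - \<sigma> ` X" for a X \<sigma> v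
    using that by (auto simp: conf_def inj_on_def)
  have card_ext: "card (extensions W X \<sigma>) = fact (card W - card X)" if "conf X \<sigma>" for X \<sigma>
    using that W by (intro card_extensions) (auto simp: conf_def)
  have finX: "finite X" if "conf X \<sigma>" for X \<sigma>
    using that W finite_subset by (auto simp: conf_def)
  have Verdict: "accepting W g (Verdict v) X \<tau> = (if v then fact (card W - card X) else 0)"
    if "conf X \<tau>" for g :: "'s \<Rightarrow> nat \<Rightarrow> nat" and v X \<tau>
    using card_ext[OF that] by (simp add: accepting_def)
  \<comment> \<open>A query reveals at most two names, its argument and its answer, whence
    \<open>card X + 2 * q\<close>. The factorial is the number of compatible relabellings, so the
    error is \<open>q * \<delta>\<close> as a conditional probability.\<close>
  have "accepting W f t X \<sigma> \<le> accepting W f' t X \<sigma>' + q * \<delta> * fact (card W - card X)"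
    if "conf X \<sigma>" "conf X \<sigma>'" "same_pattern (2 * q) X f f' \<sigma> \<sigma>'" "card X + 2 * q \<le> 2 * Q"
      "within_budget W f q t X \<sigma>" for q t X \<sigma> \<sigma>'
    using that
  proof (induction q arbitrary: t X \<sigma> \<sigma>')
    case 0
    have "extensions W X \<sigma> \<noteq> {}" using card_ext[OF 0(1)] by (metis card.empty fact_nonzero)
    then obtain \<pi> where "\<pi> \<in> extensions W X \<sigma>" by blast
    \<comment> \<open>With no query left the tree is a verdict, which is the same for
      \<open>f'\<close>.\<close>
    then have "queries (graph_of W (relabel \<pi> f)) t = []"
      using 0(5) by (auto simp: within_budget_def Let_def)
    then obtain v where "t = Verdict v" by (cases t) auto
    then show ?case using Verdict[OF 0(1)] Verdict[OF 0(2)] by simp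
  next
    case (Suc q)
    show ?case
    proof (cases t)
      case t: (Verdict v)
      then show ?thesis using Verdict[OF Suc.prems(1)] Verdict[OF Suc.prems(2)] \<delta>(1) by simp
    next
      case t: (Query x l k)
      \<comment> \<open>A query whose argument is already named adds no error. The
        \<open>+ 1\<close> in the bound on \<open>card Y\<close> leaves room for naming the
        answer.\<close>
      have known: "accepting W f t Y \<tau> \<le> accepting W f' t Y \<tau>' + q * \<delta> * fact (card W - card Y)"
        if Y: "conf Y \<tau>" "conf Y \<tau>'" "same_pattern (2 * Suc q) Y f f' \<tau> \<tau>'"
          "card Y + 2 * q + 1 \<le> 2 * Q" "within_budget W f (Suc q) t Y \<tau>" and x: "x \<in> Y"
        for Y \<tau> \<tau>'
      proof -
        define y where "y = lact f l (\<tau> x)"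
        define y' where "y' = lact f' l (\<tau>' x)"
        have xW: "x \<in> W" using x Y(1) by (auto simp: conf_def)
        have yW: "y \<in> W" "y' \<in> W"
          using x Y(1,2) lact_in[OF f(1)] lact_in[OF f(2)] by (auto simp: y_def y'_def conf_def)
        \<comment> \<open>\<open>y\<close> and \<open>y'\<close> are one letter away from the
          vertices named \<open>x\<close>, so the pattern decides alike in both graphs whether they
          already have a name, and which.\<close>
        have iff: "y = \<tau> b \<longleftrightarrow> y' = \<tau>' b" if "b \<in> Y" for b
          using same_patternD[OF Y(3) x that, of "[l]"] by (simp add: y_def y'_def)
        show ?thesis
        proof (cases "y \<in> \<tau> ` Y")
          case True
          then obtain b where b: "b \<in> Y" "y = \<tau> b" by blast
          then have b': "y' = \<tau>' b" using iff by simp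
          have "accepting W f t Y \<tau> = accepting W f (k b) Y \<tau>"
            unfolding t using accepting_known_answer(1)[OF f(1) x xW b(1)] b(2) by (simp add: y_def)
          moreover have "accepting W f' t Y \<tau>' = accepting W f' (k b) Y \<tau>'"
            unfolding t using accepting_known_answer(1)[OF f(2) x xW b(1)] b' by (simp add: y'_def)
          moreover have "within_budget W f q (k b) Y \<tau>"
            using accepting_known_answer(2)[OF f(1) x xW b(1) _ Y(5)[unfolded t]] b(2) by (simp add: y_def)
          ultimately show ?thesis
            using Suc.IH[OF Y(1,2) same_pattern_mono[OF Y(3)], of "k b"] Y(4) by simp
        next
          case False
          then have False': "y' \<notin> \<tau>' ` Y" using iff by blast
          have YW: "Y \<subseteq> W" using Y(1) by (simp add: conf_def)
          have finY: "finite Y" using finX[OF Y(1)] .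
          \<comment> \<open>The unnamed vertices \<open>y\<close> and \<open>y'\<close> receive the
            same name \<open>b\<close>. All free names are equally likely in both graphs, so the
            comparison is made for each \<open>b\<close> separately.\<close>
          have step: "accepting W f t (insert b Y) (\<tau>(b := y))
              \<le> accepting W f' t (insert b Y) (\<tau>'(b := y')) + q * \<delta> * fact (card W - Suc (card Y))"
            if b: "b \<in> W - Y" for b
          proof -
            have xb: "x \<noteq> b" using x b by auto
            have "accepting W f t (insert b Y) (\<tau>(b := y)) = accepting W f (k b) (insert b Y) (\<tau>(b := y))"
              unfolding t by (rule accepting_known_answer(1)[OF f(1)]) (use x xW xb in \<open>auto simp: y_def\<close>)
            moreover have "accepting W f' t (insert b Y) (\<tau>'(b := y'))
                = accepting W f' (k b) (insert b Y) (\<tau>'(b := y'))"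
              unfolding t by (rule accepting_known_answer(1)[OF f(2)]) (use x xW xb in \<open>auto simp: y'_def\<close>)
            moreover have "within_budget W f q (k b) (insert b Y) (\<tau>(b := y))"
            proof (rule accepting_known_answer(2)[OF f(1)])
              show "within_budget W f (Suc q) (Query x l k) (insert b Y) (\<tau>(b := y))"
                using within_budget_insert[OF _ Y(5)] b t by simp
            qed (use x xW xb in \<open>auto simp: y_def\<close>)
            moreover have "same_pattern (2 * q) (insert b Y) f f' (\<tau>(b := y)) (\<tau>'(b := y'))"
              unfolding y_def y'_def
              using same_pattern_insert_neighbour[OF f _ x, of "2 * q"] Y(3) b by simp
            moreover have "conf (insert b Y) (\<tau>(b := y))" "conf (insert b Y) (\<tau>'(b := y'))"
              using conf_insert Y(1,2) b yW False False' by auto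
            moreover have "card (insert b Y) = Suc (card Y)" using b finY by simp
            ultimately show ?thesis
              using Suc.IH[of "insert b Y" "\<tau>(b := y)" "\<tau>'(b := y')" "k b"] Y(4) by (simp del: fun_upd_apply)
          qed
          have card_diff: "card (W - Y) = card W - card Y"
            using YW finY by (simp add: card_Diff_subset)
          have pos: "card W - card Y > 0"
          proof -
            have "card Y = card (\<tau> ` Y)" using Y(1) by (simp add: conf_def card_image)
            also have "\<dots> < card W"
              using False yW(1) Y(1) W by (intro psubset_card_mono) (auto simp: conf_def)
            finally show ?thesis by simp
          qed
          have fact: "(card W - card Y) * fact (card W - Suc (card Y)) = (fact (card W - card Y) :: real)"
            using pos fact_reduce[of "card W - card Y", where ?'a = real] by simp
          have "accepting W f t Y \<tau> = (\<Sum>b\<in>W - Y. accepting W f t (insert b Y) (\<tau>(b := y)))"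
            unfolding accepting_def using W YW yW False by (intro card_extensions_by_vertex) auto
          then have "real (accepting W f t Y \<tau>) = (\<Sum>b\<in>W - Y. real (accepting W f t (insert b Y) (\<tau>(b := y))))"
            by simp
          also have "\<dots> \<le> (\<Sum>b\<in>W - Y. accepting W f' t (insert b Y) (\<tau>'(b := y')) + q * \<delta> * fact (card W - Suc (card Y)))"
            using step by (rule sum_mono)
          also have "\<dots> = (\<Sum>b\<in>W - Y. accepting W f' t (insert b Y) (\<tau>'(b := y')))
              + q * \<delta> * ((card W - card Y) * fact (card W - Suc (card Y)))"
            by (simp add: sum.distrib card_diff)
          also have "(\<Sum>b\<in>W - Y. accepting W f' t (insert b Y) (\<tau>'(b := y'))) = accepting W f' t Y \<tau>'"
            unfolding accepting_def using W YW yW False' by (intro card_extensions_by_vertex[symmetric]) auto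
          finally show ?thesis by (simp only: fact)
        qed
      qed
      have qQ: "card X + 2 * q + 2 \<le> 2 * Q" using Suc.prems(4) by simp
      show ?thesis
      proof (cases "x \<in> X")
        case True
        have "real q * \<delta> * fact (card W - card X) \<le> real (Suc q) * \<delta> * fact (card W - card X)"
          using \<delta>(1) by (intro mult_right_mono) auto
        with known[OF Suc.prems(1-3) _ Suc.prems(5) True] qQ show ?thesis by simp
      next
        case False
        have "extensions W X \<sigma> \<noteq> {}"
          using card_ext[OF Suc.prems(1)] by (metis card.empty fact_nonzero)
        then obtain \<pi> where "\<pi> \<in> extensions W X \<sigma>" by blast
        then have xW: "x \<in> W" using Suc.prems(5) t by (auto simp: within_budget_def Let_def)
        have XW: "X \<subseteq> W" using Suc.prems(1) by (simp add: conf_def)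
        have fX: "finite X" using finX[OF Suc.prems(1)] .
        have lt: "card X < card W" using XW xW False W by (intro psubset_card_mono) auto
        \<comment> \<open>The vertices reachable from revealed ones by words of length at most
          \<open>2 * Q\<close>, in either graph. A random vertex among them could satisfy a relation
          in one graph that fails in the other.\<close>
        define B where "B = (\<lambda>(a, u). wact f u (\<sigma> a)) ` (X \<times> words (2 * Q))"
        define B' where "B' = (\<lambda>(a, u). wact f' u (\<sigma>' a)) ` (X \<times> words (2 * Q))"
        have finB: "finite B" "finite B'" using fX by (simp_all add: B_def B'_def)
        have "card B \<le> card (X \<times> (words (2 * Q) :: 's sword set))"
          "card B' \<le> card (X \<times> (words (2 * Q) :: 's sword set))"
          unfolding B_def B'_def using fX by (simp_all only: card_image_le finite_cartesian_product finite_words)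
        then have cardB: "card B \<le> card X * K" "card B' \<le> card X * K"
          by (simp_all add: card_cartesian_product K_def)
        define H where "H = {v\<in>M. v \<notin> B \<and> \<phi> v \<notin> B'}"
        have Nil: "[] \<in> words (2 * Q)" by (simp add: words_def)
        have sub: "\<sigma> ` X \<subseteq> B" "\<sigma>' ` X \<subseteq> B'"
        proof -
          show "\<sigma> ` X \<subseteq> B"
          proof
            fix z assume "z \<in> \<sigma> ` X"
            then obtain a where "a \<in> X" "z = wact f [] (\<sigma> a)" by auto
            then show "z \<in> B" using Nil unfolding B_def by force
          qed
          show "\<sigma>' ` X \<subseteq> B'"
          proof
            fix z assume "z \<in> \<sigma>' ` X"
            then obtain a where "a \<in> X" "z = wact f' [] (\<sigma>' a)" by auto
            then show "z \<in> B'" using Nil unfolding B'_def by force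
          qed
        qed
        have HW: "H \<subseteq> W - \<sigma> ` X" using sub \<phi>(2) by (auto simp: H_def)
        have \<phi>H: "\<phi> ` H \<subseteq> W - \<sigma>' ` X" using sub \<phi>(3) by (auto simp: H_def)
        have inj\<phi>: "inj_on \<phi> H" using \<phi>(1) by (rule inj_on_subset) (auto simp: H_def)
        let ?N = "\<lambda>v. accepting W f t (insert x X) (\<sigma>(x := v))"
        let ?N' = "\<lambda>v. accepting W f' t (insert x X) (\<sigma>'(x := v))"
        let ?F = "fact (card W - Suc (card X)) :: real"
        have fact: "real (card W - card X) * ?F = fact (card W - card X)"
          using lt fact_reduce[of "card W - card X", where ?'a = real] by simp
        have good: "?N v \<le> ?N' (\<phi> v) + q * \<delta> * ?F" if v: "v \<in> H" for v
        proof -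
          have "local_type (2 * Suc q) f v = local_type (2 * Suc q) f' (\<phi> v)"
          proof -
            have "v \<in> M" using v by (simp add: H_def)
            from \<phi>(4)[OF this] have "wact f u v = v \<longleftrightarrow> wact f' u (\<phi> v) = \<phi> v" if "length u \<le> 2 * Q" for u
              using that by (auto simp: local_type_def words_def)
            then show ?thesis using Suc.prems(4) by (auto simp: local_type_def words_def)
          qed
          moreover have "wact f u (\<sigma> a) \<noteq> v" "wact f' u (\<sigma>' a) \<noteq> \<phi> v"
            if "a \<in> X" "u \<in> words (2 * Suc q)" for a u
          proof -
            have "(a, u) \<in> X \<times> words (2 * Q)" using that Suc.prems(4) by (simp add: words_def)
            then have "wact f u (\<sigma> a) \<in> B" "wact f' u (\<sigma>' a) \<in> B'"
              unfolding B_def B'_def by force+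
            then show "wact f u (\<sigma> a) \<noteq> v" "wact f' u (\<sigma>' a) \<noteq> \<phi> v" using v by (auto simp: H_def)
          qed
          ultimately have "same_pattern (2 * Suc q) (insert x X) f f' (\<sigma>(x := v)) (\<sigma>'(x := \<phi> v))"
            using Suc.prems(3) False by (intro same_pattern_insert_isolated[OF f]) auto
          moreover have "conf (insert x X) (\<sigma>(x := v))" "conf (insert x X) (\<sigma>'(x := \<phi> v))"
            using conf_insert Suc.prems(1,2) xW False HW \<phi>H v by auto
          moreover have "within_budget W f (Suc q) t (insert x X) (\<sigma>(x := v))"
            using False Suc.prems(5) by (rule within_budget_insert)
          moreover have "card (insert x X) = Suc (card X)" using False fX by simp
          ultimately show ?thesis
            using known[of "insert x X" "\<sigma>(x := v)" "\<sigma>'(x := \<phi> v)"] qQ by simp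
        qed
        \<comment> \<open>For a vertex outside \<open>H\<close> acceptance is conceded on every
          compatible relabelling.\<close>
        have bad: "?N v \<le> ?F" if v: "v \<in> W - \<sigma> ` X" for v
        proof -
          have "conf (insert x X) (\<sigma>(x := v))" using conf_insert Suc.prems(1) xW False v by auto
          from card_ext[OF this] have "card (extensions W (insert x X) (\<sigma>(x := v))) = fact (card W - Suc (card X))"
            using False fX by simp
          moreover have "?N v \<le> card (extensions W (insert x X) (\<sigma>(x := v)))"
            unfolding accepting_def using W by (intro card_mono) auto
          ultimately have "?N v \<le> (fact (card W - Suc (card X)) :: nat)" by simp
          then have "real (?N v) \<le> real (fact (card W - Suc (card X)))" by (rule of_nat_mono)
          then show ?thesis by simp
        qed
        \<comment> \<open>Excluded are the unmatched vertices, \<open>B\<close> and the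
          \<open>\<phi>\<close>-preimage of \<open>B'\<close>. At most \<open>2 * Q\<close> names
          have been revealed, which explains both \<open>4 * Q\<close> and
          \<open>card W - 2 * Q\<close> in the assumption on \<open>\<delta>\<close>.\<close>
        have card_bad: "real (card (W - \<sigma> ` X - H)) \<le> \<delta> * real (card W - card X)"
        proof -
          have "W - \<sigma> ` X - H \<subseteq> (W - M) \<union> (B \<union> {v\<in>M. \<phi> v \<in> B'})" by (auto simp: H_def)
          moreover have finM: "finite M" using \<phi>(2) W by (rule finite_subset)
          ultimately have "card (W - \<sigma> ` X - H) \<le> card ((W - M) \<union> (B \<union> {v\<in>M. \<phi> v \<in> B'}))"
            using W finB by (intro card_mono) auto
          also have "\<dots> \<le> card (W - M) + (card B + card {v\<in>M. \<phi> v \<in> B'})"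
            by (meson add_left_mono card_Un_le le_trans)
          also have "card {v\<in>M. \<phi> v \<in> B'} \<le> card B'"
            using finB \<phi>(1) by (intro card_inj_on_le[of \<phi>]) (auto intro: inj_on_subset)
          finally have "card (W - \<sigma> ` X - H) \<le> card (W - M) + 2 * (card X * K)"
            using cardB by linarith
          also have "2 * (card X * K) \<le> 2 * (2 * Q * K)"
            using Suc.prems(4) by (intro mult_left_mono mult_right_mono) auto
          finally have "card (W - \<sigma> ` X - H) \<le> card (W - M) + 4 * Q * K" by simp
          then have "real (card (W - \<sigma> ` X - H)) \<le> real (card (W - M) + 4 * Q * K)" by (rule of_nat_mono)
          also have "\<dots> \<le> \<delta> * (real (card W) - 2 * Q)" using \<delta>(2) by (simp add: K_def)
          also have "\<dots> \<le> \<delta> * real (card W - card X)"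
            using \<delta>(1) Suc.prems(4) lt by (intro mult_left_mono) auto
          finally show ?thesis .
        qed
        have finWX: "finite (W - \<sigma> ` X)" using W by simp
        have "accepting W f t X \<sigma> = (\<Sum>v\<in>W - \<sigma> ` X. ?N v)"
          unfolding accepting_def using W xW False by (intro card_extensions_by_label) auto
        then have "real (accepting W f t X \<sigma>) = (\<Sum>v\<in>W - \<sigma> ` X. real (?N v))" by simp
        also have "\<dots> = (\<Sum>v\<in>W - \<sigma> ` X - H. real (?N v)) + (\<Sum>v\<in>H. real (?N v))"
          using sum.subset_diff[OF HW finWX] .
        also have "(\<Sum>v\<in>W - \<sigma> ` X - H. real (?N v)) \<le> (\<Sum>v\<in>W - \<sigma> ` X - H. ?F)"
          using bad by (intro sum_mono) auto
        also have "(\<Sum>v\<in>W - \<sigma> ` X - H. ?F) \<le> \<delta> * real (card W - card X) * ?F"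
          using card_bad by (simp add: mult_right_mono)
        also have "(\<Sum>v\<in>H. real (?N v)) \<le> (\<Sum>v\<in>H. ?N' (\<phi> v) + q * \<delta> * ?F)"
          using good by (rule sum_mono)
        also have "(\<Sum>v\<in>H. ?N' (\<phi> v) + q * \<delta> * ?F)
            = (\<Sum>v\<in>\<phi> ` H. real (?N' v)) + real (card H) * (q * \<delta> * ?F)"
          using inj\<phi> by (simp add: sum.distrib sum.reindex)
        also have "(\<Sum>v\<in>\<phi> ` H. real (?N' v)) \<le> (\<Sum>v\<in>W - \<sigma>' ` X. real (?N' v))"
          using \<phi>H W by (intro sum_mono2) auto
        also have "(\<Sum>v\<in>W - \<sigma>' ` X. real (?N' v)) = accepting W f' t X \<sigma>'"
        proof -
          have "accepting W f' t X \<sigma>' = (\<Sum>v\<in>W - \<sigma>' ` X. ?N' v)"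
            unfolding accepting_def using W xW False by (intro card_extensions_by_label) auto
          then show ?thesis by simp
        qed
        also have "real (card H) * (q * \<delta> * ?F) \<le> real (card W - card X) * (q * \<delta> * ?F)"
        proof (rule mult_right_mono)
          have "card H \<le> card (W - \<sigma> ` X)" using HW finWX by (rule card_mono[rotated])
          also have "\<dots> = card W - card X"
            using Suc.prems(1) fX by (simp add: conf_def card_Diff_subset card_image)
          finally show "real (card H) \<le> real (card W - card X)" by simp
        qed (use \<delta>(1) in simp)
        finally have "real (accepting W f t X \<sigma>) \<le> accepting W f' t X \<sigma>'
            + (\<delta> + q * \<delta>) * (real (card W - card X) * ?F)"
          by (simp add: algebra_simps)
        then show ?thesis unfolding fact by (simp add: algebra_simps)
      qed
    qed
  qed
  from this[of "{}" \<sigma> \<sigma>' Q t] budget show ?thesis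
    by (simp add: conf_def same_pattern_def)
qed

section \<open>Local statistics\<close>

lemma partial_matching:
  assumes "finite A" "finite B"
  obtains N g where "N \<subseteq> A" "inj_on g N" "g ` N \<subseteq> B" "card (A - N) \<le> card A - card B"
proof -
  obtain N where N: "N \<subseteq> A" "card N = min (card A) (card B)" "finite N"
    using obtain_subset_with_card_n[of "min (card A) (card B)" A] by auto
  then obtain g where "g ` N \<subseteq> B" "inj_on g N"
    using card_le_inj[of N B] assms(2) by auto
  moreover have "card (A - N) \<le> card A - card B"
    using N by (simp add: card_Diff_subset)
  ultimately show ?thesis using that N(1) by blast
qed

text \<open>Each colour class is matched separately as far as the sizes permit. Subtraction of
  natural numbers makes a class with enough partners contribute zero.\<close>

lemma coloured_matching:
  assumes A: "finite A" and C: "finite C" "c ` A \<subseteq> C"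
  obtains M \<phi> where "M \<subseteq> A" "inj_on \<phi> M" "\<phi> ` M \<subseteq> A" "\<And>v. v \<in> M \<Longrightarrow> c' (\<phi> v) = c v"
    "card (A - M) \<le> (\<Sum>T\<in>C. card {v\<in>A. c v = T} - card {v\<in>A. c' v = T})"
proof -
  define P where "P = (\<lambda>T N g. N \<subseteq> {v\<in>A. c v = T} \<and> inj_on g N \<and> g ` N \<subseteq> {v\<in>A. c' v = T} \<and>
      card ({v\<in>A. c v = T} - N) \<le> card {v\<in>A. c v = T} - card {v\<in>A. c' v = T})"
  have "\<exists>N g. P T N g" for T
  proof -
    have "finite {v\<in>A. c v = T}" "finite {v\<in>A. c' v = T}" using A by auto
    then obtain N g where "N \<subseteq> {v\<in>A. c v = T}" "inj_on g N" "g ` N \<subseteq> {v\<in>A. c' v = T}"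
        "card ({v\<in>A. c v = T} - N) \<le> card {v\<in>A. c v = T} - card {v\<in>A. c' v = T}"
      by (rule partial_matching)
    then show ?thesis unfolding P_def by blast
  qed
  then have "\<forall>T. \<exists>N. \<exists>g. P T N g" by blast
  from choice[OF this] obtain N where "\<forall>T. \<exists>g. P T (N T) g" by blast
  from choice[OF this] obtain g where Ng: "\<forall>T. P T (N T) (g T)" by blast
  have N: "\<And>T. N T \<subseteq> {v\<in>A. c v = T}" "\<And>T. inj_on (g T) (N T)"
      "\<And>T. g T ` N T \<subseteq> {v\<in>A. c' v = T}"
      "\<And>T. card ({v\<in>A. c v = T} - N T) \<le> card {v\<in>A. c v = T} - card {v\<in>A. c' v = T}"
    using Ng by (simp_all add: P_def)
  define M where "M = (\<Union>T\<in>C. N T)"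
  define \<phi> where "\<phi> = (\<lambda>v. g (c v) v)"
  have M: "v \<in> A \<and> v \<in> N (c v)" if v: "v \<in> M" for v
    using v N(1) by (auto simp: M_def)
  have \<phi>: "\<phi> v \<in> A \<and> c' (\<phi> v) = c v" if v: "v \<in> M" for v
    using M[OF v] N(3)[of "c v"] by (auto simp: \<phi>_def)
  have "inj_on \<phi> M"
  proof (rule inj_onI)
    fix v w assume vw: "v \<in> M" "w \<in> M" "\<phi> v = \<phi> w"
    then have "c v = c w" using \<phi>[OF vw(1)] \<phi>[OF vw(2)] by simp
    then show "v = w"
      using vw M[OF vw(1)] M[OF vw(2)] N(2)[of "c v"] by (auto simp: \<phi>_def inj_on_def)
  qed
  moreover have "card (A - M) \<le> (\<Sum>T\<in>C. card {v\<in>A. c v = T} - card {v\<in>A. c' v = T})"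
  proof -
    have "A - M \<subseteq> (\<Union>T\<in>C. {v\<in>A. c v = T} - N T)"
      using C(2) by (auto simp: M_def)
    then have "card (A - M) \<le> card (\<Union>T\<in>C. {v\<in>A. c v = T} - N T)"
      using A C(1) by (intro card_mono) auto
    also have "\<dots> \<le> (\<Sum>T\<in>C. card ({v\<in>A. c v = T} - N T))"
      using C(1) by (rule card_UN_le)
    also have "\<dots> \<le> (\<Sum>T\<in>C. card {v\<in>A. c v = T} - card {v\<in>A. c' v = T})"
      using N(4) by (rule sum_mono)
    finally show ?thesis .
  qed
  ultimately show ?thesis
    by (intro that[of M \<phi>]) (use M \<phi> in auto)
qed

section \<open>Isomorphism classes and sizes of solutions\<close>

lemma graph_iso_sym:
  assumes "graph_iso G H"
  shows "graph_iso H G"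
proof -
  obtain f where f: "bij_betw f (vertices G) (vertices H)"
    and e: "\<And>s x y. x \<in> vertices G \<Longrightarrow> y \<in> vertices G \<Longrightarrow> (x, s, y) \<in> edges G \<longleftrightarrow> (f x, s, f y) \<in> edges H"
    using assms by (auto simp: graph_iso_def)
  let ?g = "inv_into (vertices G) f"
  have g: "bij_betw ?g (vertices H) (vertices G)" using f by (rule bij_betw_inv_into)
  have "(x, s, y) \<in> edges H \<longleftrightarrow> (?g x, s, ?g y) \<in> edges G"
    if xy: "x \<in> vertices H" "y \<in> vertices H" for s x y
    using e[of "?g x" "?g y" s] bij_betwE[OF g] xy bij_betw_inv_into_right[OF f] by simp
  with g show ?thesis unfolding graph_iso_def by blast
qed

lemma graph_iso_trans:
  assumes "graph_iso G H" "graph_iso H K"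
  shows "graph_iso G K"
proof -
  obtain f where f: "bij_betw f (vertices G) (vertices H)"
    and e: "\<And>s x y. x \<in> vertices G \<Longrightarrow> y \<in> vertices G \<Longrightarrow> (x, s, y) \<in> edges G \<longleftrightarrow> (f x, s, f y) \<in> edges H"
    using assms(1) by (auto simp: graph_iso_def)
  obtain g where g: "bij_betw g (vertices H) (vertices K)"
    and e': "\<And>s x y. x \<in> vertices H \<Longrightarrow> y \<in> vertices H \<Longrightarrow> (x, s, y) \<in> edges H \<longleftrightarrow> (g x, s, g y) \<in> edges K"
    using assms(2) by (auto simp: graph_iso_def)
  have "bij_betw (g \<circ> f) (vertices G) (vertices K)" using f g by (rule bij_betw_trans)
  moreover have "(x, s, y) \<in> edges G \<longleftrightarrow> ((g \<circ> f) x, s, (g \<circ> f) y) \<in> edges K"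
    if "x \<in> vertices G" "y \<in> vertices G" for s x y
    using e[OF that, of s] e'[of "f x" "f y" s] bij_betwE[OF f] that by simp
  ultimately show ?thesis unfolding graph_iso_def by blast
qed

lemma graph_iso_initial_segment:
  fixes G :: "('v, 's) labelled_graph"
  assumes "S_graph G" "finite (vertices G)"
  obtains K :: "(nat, 's) labelled_graph" where "graph_iso G K" "vertices K = {0..<card (vertices G)}"
    "edges K \<subseteq> vertices K \<times> UNIV \<times> vertices K"
proof -
  let ?W = "{0..<card (vertices G)}"
  obtain b where b: "bij_betw b (vertices G) ?W"
    using ex_bij_betw_finite_nat[OF assms(2)] by blast
  have sub: "edges G \<subseteq> vertices G \<times> UNIV \<times> vertices G" using assms(1) by (simp add: S_graph_def)
  define K where "K = \<lparr>vertices = ?W, edges = (\<lambda>(x, s, y). (b x, s, b y)) ` edges G\<rparr>"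
  have inj: "inj_on b (vertices G)" using b by (simp add: bij_betw_def)
  have "(x, s, y) \<in> edges G \<longleftrightarrow> (b x, s, b y) \<in> edges K"
    if xy: "x \<in> vertices G" "y \<in> vertices G" for s x y
  proof
    assume "(x, s, y) \<in> edges G"
    then show "(b x, s, b y) \<in> edges K" by (force simp: K_def)
  next
    assume "(b x, s, b y) \<in> edges K"
    then obtain x' y' where "(x', s, y') \<in> edges G" "b x = b x'" "b y = b y'" by (auto simp: K_def)
    moreover from this have "x' \<in> vertices G" "y' \<in> vertices G" using sub by auto
    ultimately show "(x, s, y) \<in> edges G" using inj_onD[OF inj] xy by metis
  qed
  then have "graph_iso G K"
    unfolding graph_iso_def using b by (auto simp: K_def)
  moreover have "edges K \<subseteq> vertices K \<times> UNIV \<times> vertices K"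
    using sub bij_betwE[OF b] by (fastforce simp: K_def)
  ultimately show ?thesis by (intro that[of K]) (simp_all add: K_def)
qed

text \<open>Under a bound on the sizes, each class consists of the solutions isomorphic to one of
  finitely many labelled graphs on an initial segment of the natural numbers.\<close>

lemma infinite_solution_sizes:
  fixes E :: "('s::finite) relations"
  assumes "infinite (FGSol E)"
  shows "infinite ((\<lambda>G. card (vertices G)) ` finite_connected_GSol E)"
proof
  assume "finite ((\<lambda>G. card (vertices G)) ` finite_connected_GSol E)"
  then obtain B where B: "\<And>G. G \<in> finite_connected_GSol E \<Longrightarrow> card (vertices G) \<le> B"
    by (auto simp: finite_nat_set_iff_bounded_le)
  define Codes :: "(nat, 's) labelled_graph set" where
    "Codes = (\<lambda>(V, e). \<lparr>vertices = V, edges = e\<rparr>) ` (Pow {0..<B} \<times> Pow ({0..<B} \<times> UNIV \<times> {0..<B}))"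
  have "FGSol E \<subseteq> (\<lambda>K. {H \<in> finite_connected_GSol E. graph_iso K H}) ` Codes"
  proof
    fix C assume "C \<in> FGSol E"
    then obtain G where G: "G \<in> finite_connected_GSol E"
      and C: "C = {H \<in> finite_connected_GSol E. graph_iso G H}"
      by (auto simp: FGSol_def quotient_def)
    have "S_graph G" "finite (vertices G)" using G by (simp_all add: finite_connected_GSol_def GSol_def)
    then obtain K :: "(nat, 's) labelled_graph" where K: "graph_iso G K"
        "vertices K = {0..<card (vertices G)}" "edges K \<subseteq> vertices K \<times> UNIV \<times> vertices K"
      using graph_iso_initial_segment by blast
    have "graph_iso G H \<longleftrightarrow> graph_iso K H" for H :: "(nat, 's) labelled_graph"
      using K(1) graph_iso_sym graph_iso_trans by metis
    with C have "C = {H \<in> finite_connected_GSol E. graph_iso K H}" by simp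
    moreover have "K \<in> Codes"
    proof -
      have "vertices K \<subseteq> {0..<B}" using K(2) B[OF G] by auto
      with K(3) have "edges K \<subseteq> {0..<B} \<times> UNIV \<times> {0..<B}" by blast
      with \<open>vertices K \<subseteq> {0..<B}\<close>
      have "(vertices K, edges K) \<in> Pow {0..<B} \<times> Pow ({0..<B} \<times> UNIV \<times> {0..<B})" by simp
      moreover have "K = (\<lambda>(V, e). \<lparr>vertices = V, edges = e\<rparr>) (vertices K, edges K)" by simp
      ultimately show ?thesis unfolding Codes_def by (rule image_eqI[rotated])
    qed
    ultimately show "C \<in> (\<lambda>K. {H \<in> finite_connected_GSol E. graph_iso K H}) ` Codes" by blast
  qed
  moreover have "finite Codes" by (simp add: Codes_def)
  ultimately have "finite (FGSol E)" using finite_surj by blast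
  with assms show False by simp
qed

text \<open>Through \<open>p\<close>, \<open>W\<close> is a part of \<open>V\<close>. Where
  \<open>h s\<close> stays in that part it is followed, and the resulting partial injection is
  completed arbitrarily. The points where this fails are sent by \<open>h s\<close>, injectively, to
  the \<open>card V - card W\<close> missing points.\<close>

lemma patched_action:
  fixes h :: "'s \<Rightarrow> 'v \<Rightarrow> 'v"
  assumes "finite W" "finite V" "perm_action V h" "inj_on p W" "p ` W \<subseteq> V"
  obtains g where "perm_action W g" "\<And>s. card {x\<in>W. p (g s x) \<noteq> h s (p x)} \<le> card V - card W"
proof -
  have "\<exists>\<rho>. \<rho> permutes W \<and> card {x\<in>W. p (\<rho> x) \<noteq> h s (p x)} \<le> card V - card W" for s
  proof -
    define X where "X = {x\<in>W. h s (p x) \<in> p ` W}"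
    define \<sigma> where "\<sigma> = (\<lambda>x. inv_into W p (h s (p x)))"
    have injh: "inj (h s)" using perm_actionD(1)[OF assms(3)] by (rule bij_is_inj)
    have p\<sigma>: "p (\<sigma> x) = h s (p x)" if "x \<in> X" for x
      using that by (simp add: X_def \<sigma>_def f_inv_into_f)
    have "inj_on \<sigma> X"
    proof (rule inj_onI)
      fix x y assume xy: "x \<in> X" "y \<in> X" "\<sigma> x = \<sigma> y"
      then have "h s (p x) = h s (p y)" using p\<sigma>[OF xy(1)] p\<sigma>[OF xy(2)] by simp
      then have "p x = p y" using injh by (simp add: inj_eq)
      then show "x = y" using xy assms(4) by (auto simp: X_def inj_on_def)
    qed
    moreover have "\<sigma> ` X \<subseteq> W" by (auto simp: X_def \<sigma>_def inv_into_into)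
    moreover have "X \<subseteq> W" by (auto simp: X_def)
    ultimately obtain \<rho> where \<rho>: "\<rho> permutes W" "\<And>x. x \<in> X \<Longrightarrow> \<rho> x = \<sigma> x"
      using permutes_extend[OF assms(1)] by metis
    have "card {x\<in>W. p (\<rho> x) \<noteq> h s (p x)} \<le> card (V - p ` W)"
    proof (rule card_inj_on_le)
      show "inj_on (\<lambda>x. h s (p x)) {x\<in>W. p (\<rho> x) \<noteq> h s (p x)}"
        using assms(4) injh by (auto simp: inj_on_def)
      show "(\<lambda>x. h s (p x)) ` {x\<in>W. p (\<rho> x) \<noteq> h s (p x)} \<subseteq> V - p ` W"
      proof
        fix z assume "z \<in> (\<lambda>x. h s (p x)) ` {x\<in>W. p (\<rho> x) \<noteq> h s (p x)}"
        then obtain x where x: "x \<in> W" "p (\<rho> x) \<noteq> h s (p x)" "z = h s (p x)" by blast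
        have "x \<notin> X" using x(2) \<rho>(2) p\<sigma> by metis
        moreover have "h s (p x) \<in> V" using perm_actionD(2)[OF assms(3)] assms(5) x(1) by blast
        ultimately show "z \<in> V - p ` W" using x by (simp add: X_def)
      qed
    qed (use assms(2) in simp)
    also have "\<dots> = card V - card W"
      using assms by (simp add: card_Diff_subset card_image)
    finally show ?thesis using \<rho>(1) by blast
  qed
  then obtain g where "\<And>s. g s permutes W \<and> card {x\<in>W. p (g s x) \<noteq> h s (p x)} \<le> card V - card W"
    by metis
  then show ?thesis by (intro that[of g] perm_actionI) auto
qed

text \<open>If a word fails at \<open>x\<close>, then one of its letters fails at an intermediate
  point. Words act injectively, so each letter is to blame for at most \<open>r\<close> points; an
  inverse letter fails where the letter itself fails one step further.\<close>

lemma card_word_defect: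
  assumes W: "finite W" and g: "perm_action W g" and h: "perm_action V h"
    and r: "\<And>s. card {x\<in>W. p (g s x) \<noteq> h s (p x)} \<le> r"
  shows "card {x\<in>W. p (wact g u x) \<noteq> wact h u (p x)} \<le> length u * r"
proof (induction u)
  case (Cons l u)
  have letter: "card {x\<in>W. p (lact g l x) \<noteq> lact h l (p x)} \<le> r"
  proof (cases l)
    case (Pos s)
    then show ?thesis using r by simp
  next
    case (Neg s)
    have "card {x\<in>W. p (lact g l x) \<noteq> lact h l (p x)} \<le> card {x\<in>W. p (g s x) \<noteq> h s (p x)}"
    proof (rule card_inj_on_le)
      show "inj_on (lact g l) {x\<in>W. p (lact g l x) \<noteq> lact h l (p x)}"
        using inj_lact[OF g] by (rule inj_on_subset) simp
      show "lact g l ` {x\<in>W. p (lact g l x) \<noteq> lact h l (p x)} \<subseteq> {x\<in>W. p (g s x) \<noteq> h s (p x)}"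
      proof
        fix z assume "z \<in> lact g l ` {x\<in>W. p (lact g l x) \<noteq> lact h l (p x)}"
        then obtain x where x: "x \<in> W" "p (lact g l x) \<noteq> lact h l (p x)" "z = lact g l x" by blast
        have "z \<in> W" using x lact_in[OF g] by simp
        moreover have "g s z = x" using x(3) Neg perm_actionD(3)[OF g] by simp
        moreover have "p x \<noteq> h s (p z)"
        proof
          assume "p x = h s (p z)"
          then have "lact h l (p x) = p z" using Neg perm_actionD(4)[OF h] by simp
          with x show False by simp
        qed
        ultimately show "z \<in> {x\<in>W. p (g s x) \<noteq> h s (p x)}" by simp
      qed
    qed (use W in simp)
    with r show ?thesis using le_trans by blast
  qed
  have inj: "inj (wact g u)"
    using wact_word_inv[OF g] by (metis injI)
  have "{x\<in>W. p (wact g (l # u) x) \<noteq> wact h (l # u) (p x)} \<subseteq>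
      {x\<in>W. p (lact g l (wact g u x)) \<noteq> lact h l (p (wact g u x))} \<union>
      {x\<in>W. p (wact g u x) \<noteq> wact h u (p x)}" (is "?L \<subseteq> ?A \<union> ?B") by auto
  then have "card ?L \<le> card (?A \<union> ?B)" using W by (intro card_mono) auto
  also have "\<dots> \<le> card ?A + card ?B" by (rule card_Un_le)
  also have "card ?A \<le> card {x\<in>W. p (lact g l x) \<noteq> lact h l (p x)}"
    using W wact_in[OF g] by (intro card_inj_on_le[of "wact g u"] inj_on_subset[OF inj]) auto
  finally show ?case using letter Cons.IH by simp
qed simp

text \<open>The types at \<open>x\<close> and \<open>p x\<close> differ only if some word fails at
  \<open>x\<close>, which happens at no more than \<open>d * r\<close> points for each word. The
  other summand \<open>r\<close> pays for the points of \<open>V\<close> not hit by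
  \<open>p\<close>.\<close>

lemma local_type_count_le:
  fixes g :: "'s::finite \<Rightarrow> 'w \<Rightarrow> 'w" and h :: "'s \<Rightarrow> 'v \<Rightarrow> 'v"
  assumes W: "finite W" "finite V" and g: "perm_action W g" and h: "perm_action V h"
    and p: "inj_on p W" "p ` W \<subseteq> V"
    and r: "\<And>s. card {x\<in>W. p (g s x) \<noteq> h s (p x)} \<le> r" "card V - card W \<le> r"
  shows "card {v\<in>V. local_type d h v = T}
    \<le> card {x\<in>W. local_type d g x = T} + r * (1 + d * card (words d :: 's sword set))"
proof -
  let ?D = "{x\<in>W. local_type d g x \<noteq> local_type d h (p x)}"
  let ?B = "\<lambda>u. {x\<in>W. p (wact g u x) \<noteq> wact h u (p x)}"
  have "?D \<subseteq> (\<Union>u\<in>words d. ?B u)"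
  proof
    fix x assume x: "x \<in> ?D"
    then obtain u where u: "u \<in> words d" "(wact g u x = x) \<noteq> (wact h u (p x) = p x)"
      by (auto simp: local_type_def)
    have "wact g u x \<in> W" using x wact_in[OF g] by simp
    then have "wact g u x = x \<longleftrightarrow> p (wact g u x) = p x" using x p(1) by (auto simp: inj_on_def)
    then have "p (wact g u x) \<noteq> wact h u (p x)" using u(2) by auto
    with u(1) x show "x \<in> (\<Union>u\<in>words d. ?B u)" by blast
  qed
  then have "card ?D \<le> card (\<Union>u\<in>words d. ?B u)" using W by (intro card_mono) auto
  also have "\<dots> \<le> (\<Sum>u\<in>words d. card (?B u))" by (rule card_UN_le) simp
  also have "\<dots> \<le> (\<Sum>u\<in>(words d :: 's sword set). d * r)"
  proof (rule sum_mono)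
    fix u :: "'s sword" assume "u \<in> words d"
    then have "length u * r \<le> d * r" by (simp add: words_def)
    with card_word_defect[OF W(1) g h r(1), of u] show "card (?B u) \<le> d * r" by linarith
  qed
  finally have D: "card ?D \<le> r * (d * card (words d :: 's sword set))" by (simp add: mult.commute mult.left_commute)
  have "{v\<in>V. local_type d h v = T} \<subseteq> (V - p ` W) \<union> (p ` {x\<in>W. local_type d g x = T} \<union> p ` ?D)"
    by auto
  then have "card {v\<in>V. local_type d h v = T}
      \<le> card ((V - p ` W) \<union> (p ` {x\<in>W. local_type d g x = T} \<union> p ` ?D))"
    using W by (intro card_mono) auto
  also have "\<dots> \<le> card (V - p ` W) + (card (p ` {x\<in>W. local_type d g x = T}) + card (p ` ?D))"
    by (meson add_left_mono card_Un_le le_trans)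
  also have "card (V - p ` W) \<le> r"
    using W p r(2) by (simp add: card_Diff_subset card_image)
  also have "card (p ` {x\<in>W. local_type d g x = T}) \<le> card {x\<in>W. local_type d g x = T}"
    using W by (intro card_image_le) simp
  also have "card (p ` ?D) \<le> card ?D"
    using W by (intro card_image_le) simp
  finally show ?thesis using D by (simp add: algebra_simps)
qed

text \<open>The copies are the product of \<open>h\<close> with the trivial action on
  \<open>m\<close> points, so a word fixes \<open>(v, i)\<close> exactly when it fixes
  \<open>v\<close>.\<close>

lemma disjoint_copies:
  fixes h :: "'s::finite \<Rightarrow> 'v \<Rightarrow> 'v"
  assumes h: "perm_action V h" "finite V" "satisfies E V h"
    and W: "finite W" "card W = card V * m"
  obtains f where "perm_action W f" "satisfies E W f"
    "\<And>d T. card {x\<in>W. local_type d f x = T} = card {v\<in>V. local_type d h v = T} * m"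
proof -
  define F where "F = (\<lambda>s. map_prod (h s) (id :: nat \<Rightarrow> nat))"
  have id: "perm_action {0..<m} (\<lambda>s::'s. id)" by (simp add: perm_action_def)
  have "lact (\<lambda>s::'s. id) l x = x" for l and x :: nat by (cases l) simp_all
  then have "wact (\<lambda>s::'s. id) w x = x" for w and x :: nat by (induction w) simp_all
  then have wF: "wact F w (x, i) = (wact h w x, i)" for w x i
    unfolding F_def by (simp add: wact_product[OF h(1) id])
  have F: "perm_action (V \<times> {0..<m}) F"
    unfolding F_def by (rule perm_action_product[OF h(1) id])
  have sF: "satisfies E (V \<times> {0..<m}) F"
    using h(3) by (fastforce simp: satisfies_def wF)
  have "card W = card (V \<times> {0..<m})" using W(2) by (simp add: card_cartesian_product)
  then obtain b where b: "bij_betw b W (V \<times> {0..<m})"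
    using finite_same_card_bij[OF W(1), of "V \<times> {0..<m}"] h(2) by auto
  define f where "f = transport W b F"
  have type: "local_type d f x = local_type d h (fst (b x))" if "x \<in> W" for d x
  proof -
    have "wact f w x = x \<longleftrightarrow> wact h w (fst (b x)) = fst (b x)" for w
      unfolding f_def wact_transport_eq_iff[OF b F that that]
      by (cases "b x") (simp add: wF)
    then show ?thesis by (simp add: local_type_def)
  qed
  have "card {x\<in>W. local_type d f x = T} = card {v\<in>V. local_type d h v = T} * m" for d T
  proof -
    have image: "b ` {x\<in>W. local_type d f x = T} = {v\<in>V. local_type d h v = T} \<times> {0..<m}"
    proof
      show "b ` {x\<in>W. local_type d f x = T} \<subseteq> {v\<in>V. local_type d h v = T} \<times> {0..<m}"
      proof
        fix z assume "z \<in> b ` {x\<in>W. local_type d f x = T}"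
        then obtain x where "x \<in> W" "local_type d f x = T" "z = b x" by blast
        with type bij_betwE[OF b] show "z \<in> {v\<in>V. local_type d h v = T} \<times> {0..<m}"
          by (auto simp: mem_Times_iff)
      qed
      show "{v\<in>V. local_type d h v = T} \<times> {0..<m} \<subseteq> b ` {x\<in>W. local_type d f x = T}"
      proof
        fix z assume z: "z \<in> {v\<in>V. local_type d h v = T} \<times> {0..<m}"
        then have "z \<in> b ` W" using b by (auto simp: bij_betw_def)
        then obtain x where "x \<in> W" "z = b x" by blast
        with z type show "z \<in> b ` {x\<in>W. local_type d f x = T}" by auto
      qed
    qed
    have "inj_on b {x\<in>W. local_type d f x = T}"
      using b by (auto simp: bij_betw_def intro: inj_on_subset)
    from card_image[OF this] show ?thesis unfolding image by (simp add: card_cartesian_product)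
  qed
  then show ?thesis
    using that[of f] perm_action_transport[OF b F] satisfies_transport[OF b F sF]
    by (simp add: f_def)
qed

section \<open>Distance and indistinguishability\<close>

lemma hamming_dist_graph_of:
  assumes "perm_action {1..n} f" "perm_action {1..n} g"
  shows "hamming_dist n (graph_of {1..n} f) (graph_of {1..n} g)
    = (\<Sum>s\<in>UNIV. 1 / real n * real (card {x\<in>{1..n}. f s x \<noteq> g s x}))"
  unfolding hamming_dist_def
proof (intro sum.cong refl)
  fix s
  have "{x\<in>{1..n}. letter_act (graph_of {1..n} f) (Pos s) x \<noteq> letter_act (graph_of {1..n} g) (Pos s) x}
      = {x\<in>{1..n}. f s x \<noteq> g s x}"
    using letter_act_graph_of[OF assms(1), of _ "Pos s"] letter_act_graph_of[OF assms(2), of _ "Pos s"]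
    by (auto simp del: letter_act.simps)
  then show "1 / real n * real (card {x\<in>{1..n}. letter_act (graph_of {1..n} f) (Pos s) x
      \<noteq> letter_act (graph_of {1..n} g) (Pos s) x}) = 1 / real n * real (card {x\<in>{1..n}. f s x \<noteq> g s x})"
    by simp
qed

text \<open>By \<open>defect_ge\<close>, the defect of \<open>p\<close> against a solution
  \<open>g'\<close>, summed over the letters, is at least \<open>c * n / 2\<close>. The patch
  accounts for at most \<open>CARD('s) * r\<close>, no more than half of it; the rest, at least
  \<open>c * n / 4\<close>, consists of points where \<open>g\<close> and \<open>g'\<close>
  differ.\<close>

lemma patched_far:
  fixes g :: "'s::finite \<Rightarrow> nat \<Rightarrow> nat" and h :: "'s \<Rightarrow> 'v \<Rightarrow> 'v"
  assumes h: "perm_action V h" "finite V" "satisfies E V h" "\<And>x. x \<in> V \<Longrightarrow> orbit h x = V"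
    and g: "perm_action {1..n} g" and n: "0 < n" "n < card V"
    and c: "\<And>G. G \<in> finite_connected_GSol E \<Longrightarrow> ereal c \<le> cheeger G"
    and p: "p ` {1..n} \<subseteq> V" "\<And>s. card {x\<in>{1..n}. p (g s x) \<noteq> h s (p x)} \<le> r"
    and r: "4 * real CARD('s) * r \<le> c * n"
  shows "graph_of {1..n} g \<in> GSol_far E (c / 4) n"
proof -
  have ne: "{1..n} \<noteq> {}" using n(1) by simp
  have "c / 4 \<le> hamming_dist n (graph_of {1..n} g) G'" if G': "G' \<in> GSol_n E n" for G'
  proof -
    have "S_graph G'" "vertices G' = {1..n}" "G' \<in> GSol E" using G' by (auto simp: GSol_n_def S_graphs_def)
    with S_graph_imp_perm_action[of G'] obtain g' where g': "perm_action {1..n} g'" "G' = graph_of {1..n} g'"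
      by (metis finite_atLeastAtMost)
    have sat: "satisfies E {1..n} g'" using graph_of_GSol_iff[OF g'(1) ne] g'(2) \<open>G' \<in> GSol E\<close> by simp
    let ?D = "\<lambda>s. {x\<in>{1..n}. g s x \<noteq> g' s x}"
    have "c * n \<le> 2 * (\<Sum>s\<in>UNIV. real (card {x\<in>{1..n}. p (g' s x) \<noteq> h s (p x)}))"
      using defect_ge[OF h g'(1) _ sat c _ p(1)] n(2) by simp
    also have "\<dots> \<le> 2 * (\<Sum>s\<in>UNIV. real r + real (card (?D s)))"
    proof (intro mult_left_mono sum_mono)
      fix s
      have "card {x\<in>{1..n}. p (g' s x) \<noteq> h s (p x)}
          \<le> card ({x\<in>{1..n}. p (g s x) \<noteq> h s (p x)} \<union> ?D s)"
        by (intro card_mono) auto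
      also have "\<dots> \<le> card {x\<in>{1..n}. p (g s x) \<noteq> h s (p x)} + card (?D s)" by (rule card_Un_le)
      also have "\<dots> \<le> r + card (?D s)" using p(2) by simp
      finally show "real (card {x\<in>{1..n}. p (g' s x) \<noteq> h s (p x)}) \<le> real r + real (card (?D s))"
        by simp
    qed simp
    also have "\<dots> = 2 * real CARD('s) * r + 2 * (\<Sum>s\<in>UNIV. real (card (?D s)))"
      by (simp add: sum.distrib)
    finally have le: "c * n \<le> 4 * (\<Sum>s\<in>UNIV. real (card (?D s)))" using r by simp
    have "hamming_dist n (graph_of {1..n} g) G' = (\<Sum>s\<in>UNIV. real (card (?D s))) / n"
      unfolding g'(2) hamming_dist_graph_of[OF g g'(1)] by (simp add: sum_divide_distrib)
    then have "(\<Sum>s\<in>UNIV. real (card (?D s))) = hamming_dist n (graph_of {1..n} g) G' * n"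
      using n(1) by simp
    with le have "c * n \<le> 4 * hamming_dist n (graph_of {1..n} g) G' * n" by simp
    then have "c \<le> 4 * hamming_dist n (graph_of {1..n} g) G'"
      using n(1) by (simp only: mult_le_cancel_right_pos of_nat_0_less_iff)
    then show ?thesis by simp
  qed
  then show ?thesis
    using S_graph_graph_of[OF g ne] by (simp add: GSol_far_def S_graphs_def)
qed

text \<open>The averaging step of Yao's principle: over the coins of the tester, the mean number of
  accepting relabellings is at least \<open>0.99 * fact n\<close> for \<open>f\<close> and at most
  \<open>0.01 * fact n\<close> for \<open>g\<close>, so some tree in the support shows a gap above
  \<open>fact n / 2\<close>.\<close>

lemma tester_gap:
  fixes f g :: "'s::finite \<Rightarrow> nat \<Rightarrow> nat"
  assumes tester: "tester E \<epsilon> q A" and n: "0 < n"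
    and f: "perm_action {1..n} f" "satisfies E {1..n} f"
    and far: "\<And>\<pi>. \<pi> permutes {1..n} \<Longrightarrow> graph_of {1..n} (relabel \<pi> g) \<in> GSol_far E \<epsilon> n"
  obtains t where "within_budget {1..n} f q t {} id"
    "accepting {1..n} g t {} id + fact n / 2 < accepting {1..n} f t {} id"
proof -
  let ?W = "{1..n}"
  let ?S = "extensions ?W {} id"
  have ne: "?W \<noteq> {}" using n by simp
  have perm: "\<pi> permutes ?W" if "\<pi> \<in> ?S" for \<pi> using that by (simp add: extensions_def)
  have cardS: "real (card ?S) = fact n" using card_extensions[of ?W "{}" id] by simp
  have mean: "measure_pmf.expectation (A n) (\<lambda>t. real (accepting ?W k t {} id))
      = (\<Sum>\<pi>\<in>?S. measure_pmf.prob (A n) {t. accepts (graph_of ?W (relabel \<pi> k)) t})" for k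
  proof -
    have "real (accepting ?W k t {} id)
        = (\<Sum>\<pi>\<in>?S. indicator {t. accepts (graph_of ?W (relabel \<pi> k)) t} t)" for t
    proof -
      have "(\<Sum>\<pi>\<in>?S. indicator {t. accepts (graph_of ?W (relabel \<pi> k)) t} t :: real)
          = (\<Sum>\<pi>\<in>?S. if accepts (graph_of ?W (relabel \<pi> k)) t then 1 else 0)"
        by (intro sum.cong) (auto simp: indicator_def)
      also have "\<dots> = real (card {\<pi>\<in>?S. accepts (graph_of ?W (relabel \<pi> k)) t})"
        by (simp add: sum.If_cases Int_def)
      finally show ?thesis by (simp add: accepting_def)
    qed
    then show ?thesis
      by (simp add: Bochner_Integration.integral_sum integrable_measure_pmf_finite
          measure_pmf.integrable_const_bound[where B = 1] del: of_nat_sum)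
  qed
  have S_graph: "graph_of ?W k \<in> S_graphs n" if "perm_action ?W k" for k :: "'s \<Rightarrow> nat \<Rightarrow> nat"
    using S_graph_graph_of[OF that ne] by (simp add: S_graphs_def)
  have yes: "0.99 \<le> measure_pmf.prob (A n) {t. accepts (graph_of ?W (relabel \<pi> f)) t}" if "\<pi> \<in> ?S" for \<pi>
  proof -
    note p = perm_action_relabel[OF perm[OF that] f(1)]
    have "graph_of ?W (relabel \<pi> f) \<in> GSol_n E n"
      using graph_of_GSol_iff[OF p ne] satisfies_relabel[OF perm[OF that] f] S_graph[OF p]
      by (simp add: GSol_n_def)
    then show ?thesis using tester by (simp add: tester_def)
  qed
  have no: "measure_pmf.prob (A n) {t. accepts (graph_of ?W (relabel \<pi> g)) t} \<le> 0.01" if "\<pi> \<in> ?S" for \<pi>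
  proof -
    have "0.99 \<le> measure_pmf.prob (A n) {t. \<not> accepts (graph_of ?W (relabel \<pi> g)) t}"
      using tester far[OF perm[OF that]] by (simp add: tester_def)
    moreover have "measure_pmf.prob (A n) {t. \<not> accepts (graph_of ?W (relabel \<pi> g)) t}
        = 1 - measure_pmf.prob (A n) {t. accepts (graph_of ?W (relabel \<pi> g)) t}"
      using measure_pmf.prob_compl[of "{t. accepts (graph_of ?W (relabel \<pi> g)) t}" "A n"]
      by (simp add: Compl_eq_Diff_UNIV[symmetric] Collect_neg_eq)
    ultimately show ?thesis by simp
  qed
  have "\<exists>t\<in>set_pmf (A n). accepting ?W g t {} id + fact n / 2 < accepting ?W f t {} id"
  proof (rule ccontr)
    assume "\<not> ?thesis"
    then have le: "real (accepting ?W f t {} id) \<le> accepting ?W g t {} id + fact n / 2"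
      if "t \<in> set_pmf (A n)" for t using that by force
    have int: "integrable (measure_pmf (A n)) (\<lambda>t. real (accepting ?W k t {} id))" for k
    proof (rule measure_pmf.integrable_const_bound[where B = "fact n"])
      have "accepting ?W k t {} id \<le> card ?S" for t
        unfolding accepting_def by (intro card_mono) auto
      then have "real (accepting ?W k t {} id) \<le> fact n" for t
        unfolding cardS[symmetric] by simp
      then show "AE t in measure_pmf (A n). norm (real (accepting ?W k t {} id)) \<le> fact n" by simp
    qed simp
    have "0.99 * fact n = (\<Sum>\<pi>\<in>?S. 0.99 :: real)" using cardS by simp
    also have "\<dots> \<le> (\<Sum>\<pi>\<in>?S. measure_pmf.prob (A n) {t. accepts (graph_of ?W (relabel \<pi> f)) t})"
      using yes by (rule sum_mono)
    also have "\<dots> = measure_pmf.expectation (A n) (\<lambda>t. real (accepting ?W f t {} id))"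
      by (rule mean[symmetric])
    also have "\<dots> \<le> measure_pmf.expectation (A n) (\<lambda>t. accepting ?W g t {} id + fact n / 2)"
      using le int by (intro integral_mono_AE) (auto simp: AE_measure_pmf_iff)
    also have "\<dots> = measure_pmf.expectation (A n) (\<lambda>t. real (accepting ?W g t {} id)) + fact n / 2"
      using int by simp
    also have "measure_pmf.expectation (A n) (\<lambda>t. real (accepting ?W g t {} id))
        = (\<Sum>\<pi>\<in>?S. measure_pmf.prob (A n) {t. accepts (graph_of ?W (relabel \<pi> g)) t})"
      by (rule mean)
    also have "\<dots> \<le> (\<Sum>\<pi>\<in>?S. 0.01 :: real)" using no by (rule sum_mono)
    also have "\<dots> = 0.01 * fact n" using cardS by simp
    finally have "(0.99 :: real) * fact n \<le> 0.01 * fact n + fact n / 2" by simp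
    moreover have "(0 :: real) < fact n" by simp
    moreover have "\<not> 0.99 * z \<le> 0.01 * z + z / 2" if "0 < z" for z :: real
      using that by simp
    ultimately show False by blast
  qed
  then obtain t where t: "t \<in> set_pmf (A n)"
    "accepting ?W g t {} id + fact n / 2 < accepting ?W f t {} id" by blast
  have "within_budget ?W f q t {} id"
    unfolding within_budget_def Let_def
  proof
    fix \<pi> assume "\<pi> \<in> ?S"
    then have "graph_of ?W (relabel \<pi> f) \<in> S_graphs n"
      using S_graph perm_action_relabel[OF perm f(1)] by blast
    then show "length (queries (graph_of ?W (relabel \<pi> f)) t) \<le> q \<and>
        fst ` set (queries (graph_of ?W (relabel \<pi> f)) t) \<subseteq> ?W"
      using tester t(1) by (simp add: tester_def)
  qed
  with t(2) show ?thesis using that by blast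
qed

lemma finite_connected_GSol_action:
  assumes "G \<in> finite_connected_GSol E"
  obtains f where "perm_action (vertices G) f" "satisfies E (vertices G) f"
    "\<And>x. x \<in> vertices G \<Longrightarrow> orbit f x = vertices G"
proof -
  have G: "S_graph G" "finite (vertices G)" "G \<in> GSol E" "connected_graph G" "vertices G \<noteq> {}"
    using assms by (auto simp: finite_connected_GSol_def GSol_def S_graph_def)
  obtain f where f: "perm_action (vertices G) f" "G = graph_of (vertices G) f"
    using S_graph_imp_perm_action[OF G(1,2)] by blast
  have "satisfies E (vertices G) f" using graph_of_GSol_iff[OF f(1) G(5)] G(3) f(2) by metis
  moreover have "\<forall>x\<in>vertices G. orbit f x = vertices G"
    using connected_graph_of_iff[OF f(1)] G(4) f(2) by metis
  ultimately show ?thesis using that f(1) by blast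
qed

text \<open>After scaling by \<open>K\<close> both frequencies have the same integer part, so they
  lie in a common interval of length \<open>1 / K\<close>.\<close>

lemma same_rounded_frequency:
  fixes k1 k2 N1 N2 K :: nat
  assumes "k1 * K div N1 = k2 * K div N2" "0 < N1" "0 < N2" "0 < K"
  shows "real k1 / N1 \<le> real k2 / N2 + 1 / K"
proof -
  let ?b = "k1 * K div N1"
  have "k1 * K < (?b + 1) * N1"
    using dividend_less_times_div[OF assms(2), of "k1 * K"] by (simp add: algebra_simps)
  then have "real (k1 * K) < real ((?b + 1) * N1)" by (rule of_nat_less_iff[THEN iffD2])
  then have "real k1 / N1 < (real ?b + 1) / K" using assms by (simp add: field_simps)
  moreover have "?b * N2 \<le> k2 * K" unfolding assms(1) by simp
  then have "real (?b * N2) \<le> real (k2 * K)" by (rule of_nat_mono)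
  then have "real ?b / K \<le> real k2 / N2" using assms by (simp add: field_simps)
  ultimately show ?thesis by (simp add: add_divide_distrib)
qed

theorem theorem2:
  fixes E :: "('s::finite) relations"
  assumes "finite E"
    and "infinite (FGSol E)"
    and "Inf {cheeger G |G. G \<in> \<Union> (FGSol E)} > 0"
  shows "\<not> testable E"
proof
  assume testable: "testable E"
  have "finite_connected_GSol E \<subseteq> \<Union> (FGSol E)"
  proof
    fix G assume G: "G \<in> finite_connected_GSol E"
    have "graph_iso G G" unfolding graph_iso_def by (rule exI[of _ id]) simp
    with G show "G \<in> \<Union> (FGSol E)" by (auto simp: FGSol_def quotient_def)
  qed
  then have Inf_le: "Inf {cheeger G |G. G \<in> \<Union> (FGSol E)} \<le> cheeger G"
    if "G \<in> finite_connected_GSol E" for G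
    using that by (intro Inf_lower) blast
  \<comment> \<open>A real constant below the extended real infimum; \<open>c / 4\<close> is the
    distance that \<open>patched_far\<close> guarantees.\<close>
  obtain c where c: "0 < c" "ereal c < Inf {cheeger G |G. G \<in> \<Union> (FGSol E)}"
    using ereal_dense2[OF assms(3)] by auto
  have c_le: "ereal c \<le> cheeger G" if "G \<in> finite_connected_GSol E" for G
    using c(2) Inf_le[OF that] by (meson less_imp_le less_le_trans)
  obtain q A where tester: "tester E (c / 4) q A"
    using testable c(1) unfolding testable_def by (meson divide_pos_pos zero_less_numeral)
  define d where "d = 2 * q"
  define K where "K = card (words d :: 's sword set)"
  define P where "P = card (Pow (words d :: 's sword set))"
  \<comment> \<open>Chosen so that the total error \<open>q * \<delta>\<close> in
    \<open>accepting_le\<close> stays within the gap \<open>1 / 2\<close> of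
    \<open>tester_gap\<close>; the \<open>+ 1\<close> covers \<open>q = 0\<close>.\<close>
  define \<delta> :: real where "\<delta> = 1 / (2 * (q + 1))"
  have \<delta>: "0 < \<delta>" "q * \<delta> \<le> 1 / 2" by (simp_all add: \<delta>_def field_simps)
  \<comment> \<open>Rounding frequencies to multiples of \<open>1 / R\<close> costs at most
    \<open>n / R\<close> vertices for each of the \<open>P\<close> types, together at most
    \<open>\<delta> / 2 * n\<close>.\<close>
  define R where "R = Suc (nat \<lceil>2 * P / \<delta>\<rceil>)"
  have R: "0 < R" "P / R \<le> \<delta> / 2"
  proof -
    show "0 < R" by (simp add: R_def)
    have "2 * P / \<delta> \<le> R" unfolding R_def by linarith
    then show "P / R \<le> \<delta> / 2" using \<delta>(1) \<open>0 < R\<close> by (simp add: field_simps)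
  qed
  \<comment> \<open>Solutions are indexed by size, one for each, so that an infinite subset of
    \<open>Z\<close> contains arbitrarily large ones.\<close>
  define Z where "Z = (\<lambda>G. card (vertices G)) ` finite_connected_GSol E"
  define sol where "sol = (\<lambda>z V h. finite V \<and> V \<noteq> {} \<and> perm_action V h \<and> satisfies E V h \<and>
    (\<forall>x\<in>V. orbit h x = V) \<and> card (V :: nat set) = z)"
  have "\<exists>V h. sol z V h" if z: "z \<in> Z" for z
  proof -
    obtain G where G: "G \<in> finite_connected_GSol E" "z = card (vertices G)"
      using z by (auto simp: Z_def)
    obtain f where f: "perm_action (vertices G) f" "satisfies E (vertices G) f"
        "\<And>x. x \<in> vertices G \<Longrightarrow> orbit f x = vertices G"
      using finite_connected_GSol_action[OF G(1)] by blast
    have "finite (vertices G)" "vertices G \<noteq> {}"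
      using G(1) by (auto simp: finite_connected_GSol_def GSol_def S_graph_def)
    with f G(2) have "sol z (vertices G) f" by (simp add: sol_def)
    then show ?thesis by blast
  qed
  then have "\<forall>z\<in>Z. \<exists>V. \<exists>h. sol z V h" by blast
  from bchoice[OF this] obtain V where "\<forall>z\<in>Z. \<exists>h. sol z (V z) h" by blast
  from bchoice[OF this] obtain h where sol: "\<forall>z\<in>Z. sol z (V z) (h z)" by blast
  have h: "finite (V z) \<and> V z \<noteq> {} \<and> perm_action (V z) (h z) \<and>
      satisfies E (V z) (h z) \<and> (\<forall>x\<in>V z. orbit (h z) x = V z) \<and> card (V z) = z" if "z \<in> Z" for z
    using bspec[OF sol that] by (simp add: sol_def)
  define k where "k = (\<lambda>z T. card {v\<in>V z. local_type d (h z) v = T})"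
  \<comment> \<open>The rounded type frequencies. Restriction to \<open>Pow (words d)\<close> puts
    the keys into a finite function space.\<close>
  define key where "key = (\<lambda>z. \<lambda>T\<in>Pow (words d). k z T * R div z)"
  have "key z \<in> Pow (words d) \<rightarrow>\<^sub>E {0..R}" if z: "z \<in> Z" for z
  proof -
    have "k z T * R div z \<le> R" for T
    proof -
      have "k z T \<le> z" unfolding k_def using card_mono[of "V z" "{v\<in>V z. local_type d (h z) v = T}"] h[OF z] by auto
      then have "k z T * R div z \<le> z * R div z" by (intro div_le_mono mult_right_mono) auto
      also have "\<dots> \<le> R" by simp
      finally show ?thesis .
    qed
    then show ?thesis by (auto simp: key_def)
  qed
  then have "key ` Z \<subseteq> Pow (words d) \<rightarrow>\<^sub>E {0..R}" by blast
  moreover have "finite (Pow (words d :: 's sword set) \<rightarrow>\<^sub>E {0..R})" by (intro finite_PiE) auto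
  ultimately have "finite (key ` Z)" by (rule finite_subset)
  moreover have "infinite Z" unfolding Z_def by (rule infinite_solution_sizes[OF assms(2)])
  \<comment> \<open>\<open>N1\<close> is taken from an infinite class, so \<open>N2\<close> can be
    chosen afterwards, as large as \<open>N1\<close> demands.\<close>
  ultimately obtain N1 where N1: "N1 \<in> Z" "infinite {z\<in>Z. key z = key N1}"
    using pigeonhole_infinite[of Z key] by auto
  have N1_pos: "0 < N1" using h[OF N1(1)] by (metis card_gt_0_iff)
  \<comment> \<open>The errors that do not grow with \<open>n\<close>: patching costs
    \<open>N1 * (1 + d * K)\<close> for each of the \<open>P\<close> types, and the other summands
    come from the assumption on \<open>\<delta>\<close> in \<open>accepting_le\<close>.\<close>
  define C where "C = P * (N1 * (1 + d * K)) + 4 * q * K + 2 * q * \<delta>"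
  \<comment> \<open>The first summand makes \<open>C\<close> at most
    \<open>\<delta> / 2 * n\<close>, the second meets the condition of \<open>patched_far\<close>
    with \<open>r = N1\<close>.\<close>
  define L where "L = 2 * C / \<delta> + 4 * CARD('s) * N1 / c"
  obtain N2 where N2: "N2 \<in> Z" "key N2 = key N1" "nat \<lceil>L\<rceil> + N1 < N2"
    using N1(2) by (auto simp: infinite_nat_iff_unbounded)
  have N2_pos: "0 < N2" using N2(3) by simp
  \<comment> \<open>Dividing \<open>N2 - 1\<close> instead of \<open>N2\<close> keeps
    \<open>n\<close> below \<open>N2\<close> even when \<open>N1\<close> divides
    \<open>N2\<close>.\<close>
  define m where "m = (N2 - 1) div N1"
  define n where "n = N1 * m"
  have "n + (N2 - 1) mod N1 = N2 - 1" unfolding n_def m_def by (rule mult_div_mod_eq)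
  moreover have "(N2 - 1) mod N1 < N1" using N1_pos by simp
  ultimately have n_less: "n < N2" "N2 \<le> n + N1" using N2_pos by linarith+
  have L_less: "L < n"
  proof -
    have "nat \<lceil>L\<rceil> < n" using N2(3) n_less by simp
    then show ?thesis by linarith
  qed
  have C0: "0 \<le> C" using \<delta>(1) by (simp add: C_def)
  have L1: "2 * C / \<delta> \<le> n" "4 * CARD('s) * N1 / c \<le> n"
  proof -
    have "0 \<le> 2 * C / \<delta>" "0 \<le> 4 * CARD('s) * N1 / c" using C0 \<delta>(1) c(1) by simp_all
    then show "2 * C / \<delta> \<le> n" "4 * CARD('s) * N1 / c \<le> n"
      using L_less unfolding L_def by linarith+
  qed
  have n_pos: "0 < n" using N2(3) n_less by simp
  note V1 = h[OF N1(1)] and V2 = h[OF N2(1)]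
  have freq: "real (k N1 T) / N1 \<le> real (k N2 T) / N2 + 1 / R" if "T \<in> Pow (words d)" for T
  proof (rule same_rounded_frequency)
    show "k N1 T * R div N1 = k N2 T * R div N2"
      using fun_cong[OF N2(2), of T] that by (simp add: key_def)
  qed (use N1_pos N2_pos R in auto)
  obtain f where f: "perm_action {1..n} f" "satisfies E {1..n} f"
      "\<And>d T. card {x\<in>{1..n}. local_type d f x = T} = card {v\<in>V N1. local_type d (h N1) v = T} * m"
    using disjoint_copies[of "V N1" "h N1" E "{1..n}" m] V1 by (auto simp: n_def)
  obtain p where p: "p ` {1..n} \<subseteq> V N2" "inj_on p {1..n}"
    using card_le_inj[of "{1..n}" "V N2"] V2 n_less by auto
  have "finite {1..n}" by simp
  obtain g where g: "perm_action {1..n} g"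
      "\<And>s. card {x\<in>{1..n}. p (g s x) \<noteq> h N2 s (p x)} \<le> N2 - n"
    using patched_action[of "{1..n}" "V N2" "h N2" p] V2 p by auto
  have g_le: "card {x\<in>{1..n}. p (g s x) \<noteq> h N2 s (p x)} \<le> N1" for s
    using g(2)[of s] n_less by simp
  \<comment> \<open>Relabelling \<open>g\<close> by \<open>\<pi>\<close> does not increase the
    defect once \<open>p\<close> is replaced by \<open>p \<circ> \<pi>\<close>, so one estimate
    serves all relabellings.\<close>
  have far: "graph_of {1..n} (relabel \<pi> g) \<in> GSol_far E (c / 4) n" if \<pi>: "\<pi> permutes {1..n}" for \<pi>
  proof (rule patched_far[where h = "h N2" and V = "V N2" and p = "p \<circ> \<pi>" and r = N1])
    show "perm_action {1..n} (relabel \<pi> g)" using \<pi> g(1) by (rule perm_action_relabel)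
    have "(p \<circ> \<pi>) ` {1..n} = p ` {1..n}" by (metis \<pi> image_comp permutes_image)
    then show "(p \<circ> \<pi>) ` {1..n} \<subseteq> V N2" using p(1) by simp
    show "card {x\<in>{1..n}. (p \<circ> \<pi>) (relabel \<pi> g s x) \<noteq> h N2 s ((p \<circ> \<pi>) x)} \<le> N1" for s
    proof -
      have "card {x\<in>{1..n}. (p \<circ> \<pi>) (relabel \<pi> g s x) \<noteq> h N2 s ((p \<circ> \<pi>) x)}
          \<le> card {x\<in>{1..n}. p (g s x) \<noteq> h N2 s (p x)}"
      proof (rule card_inj_on_le)
        show "inj_on \<pi> {x\<in>{1..n}. (p \<circ> \<pi>) (relabel \<pi> g s x) \<noteq> h N2 s ((p \<circ> \<pi>) x)}"
          using permutes_inj[OF \<pi>] by (rule inj_on_subset) simp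
        show "\<pi> ` {x\<in>{1..n}. (p \<circ> \<pi>) (relabel \<pi> g s x) \<noteq> h N2 s ((p \<circ> \<pi>) x)}
            \<subseteq> {x\<in>{1..n}. p (g s x) \<noteq> h N2 s (p x)}"
          using permutes_in_image[OF \<pi>] permutes_inverses(1)[OF \<pi>] by (auto simp: relabel_def)
      qed simp
      with g_le show ?thesis using le_trans by blast
    qed
    show "4 * real CARD('s) * real N1 \<le> c * real n"
      using L1(2) c(1) by (simp add: field_simps)
  qed (use V2 n_pos n_less c_le in auto)
  obtain t where t: "within_budget {1..n} f q t {} id"
      "accepting {1..n} g t {} id + fact n / 2 < accepting {1..n} f t {} id"
    using tester_gap[OF tester n_pos f(1,2) far] by blast
  obtain M \<phi> where M: "M \<subseteq> {1..n}" "inj_on \<phi> M" "\<phi> ` M \<subseteq> {1..n}"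
      "\<And>v. v \<in> M \<Longrightarrow> local_type d g (\<phi> v) = local_type d f v"
      "card ({1..n} - M) \<le> (\<Sum>T\<in>Pow (words d). card {v\<in>{1..n}. local_type d f v = T}
         - card {v\<in>{1..n}. local_type d g v = T})"
  proof (rule coloured_matching[of "{1..n}" "Pow (words d)" "local_type d f" "local_type d g"])
    show "local_type d f ` {1..n} \<subseteq> Pow (words d)" by (auto simp: local_type_def)
  qed auto
  \<comment> \<open>The copies have exactly the frequencies of \<open>V N1\<close>; rounding
    compares these with the frequencies of \<open>V N2\<close>, and patching compares the latter
    with \<open>g\<close>.\<close>
  have diff: "real (card {v\<in>{1..n}. local_type d f v = T} - card {v\<in>{1..n}. local_type d g v = T})
      \<le> N1 * (1 + d * K) + real n / R" if "T \<in> Pow (words d)" for T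
  proof -
    have "k N2 T \<le> card {x\<in>{1..n}. local_type d g x = T} + N1 * (1 + d * K)"
      unfolding k_def K_def
    proof (rule local_type_count_le)
      show "card (V N2) - card {1..n} \<le> N1" using V2 n_less by simp
    qed (use V2 g(1) g_le p in auto)
    then have g_count: "real (k N2 T) \<le> card {x\<in>{1..n}. local_type d g x = T} + real (N1 * (1 + d * K))"
      by (metis of_nat_add of_nat_mono)
    have "card {v\<in>{1..n}. local_type d f v = T} = k N1 T * m" by (simp only: f(3) k_def)
    then have "real (card {v\<in>{1..n}. local_type d f v = T}) = n * (real (k N1 T) / N1)"
      using N1_pos by (simp add: n_def)
    also have "\<dots> \<le> n * (real (k N2 T) / N2 + 1 / R)"
      using freq[OF that] by (rule mult_left_mono) simp
    also have "\<dots> = n * (real (k N2 T) / N2) + real n / R" by (simp add: algebra_simps)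
    also have "n * (real (k N2 T) / N2) \<le> N2 * (real (k N2 T) / N2)"
      using n_less by (intro mult_right_mono) auto
    also have "\<dots> = k N2 T" using N2_pos by simp
    finally have "real (card {v\<in>{1..n}. local_type d f v = T}) \<le> k N2 T + real n / R" by simp
    with g_count have "real (card {v\<in>{1..n}. local_type d f v = T})
        \<le> card {x\<in>{1..n}. local_type d g x = T} + real (N1 * (1 + d * K)) + real n / R"
      by linarith
    moreover have "0 \<le> real (N1 * (1 + d * K)) + real n / R" by simp
    moreover have "real (a - b) \<le> x + y" if "real a \<le> real b + x + y" "0 \<le> x + y" for a b :: nat and x y
      using that by (cases "b \<le> a") (simp_all add: of_nat_diff)
    ultimately show ?thesis by blast
  qed
  have "real (card ({1..n} - M)) \<le> real (\<Sum>T\<in>Pow (words d :: 's sword set).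
      card {v\<in>{1..n}. local_type d f v = T} - card {v\<in>{1..n}. local_type d g v = T})"
    using M(5) by (rule of_nat_mono)
  also have "\<dots> = (\<Sum>T\<in>Pow (words d :: 's sword set).
      real (card {v\<in>{1..n}. local_type d f v = T} - card {v\<in>{1..n}. local_type d g v = T}))"
    by (rule of_nat_sum)
  also have "\<dots> \<le> (\<Sum>T\<in>Pow (words d :: 's sword set). N1 * (1 + d * K) + real n / R)"
    using diff by (rule sum_mono)
  also have "\<dots> = P * (N1 * (1 + d * K)) + P / R * n" by (simp add: P_def distrib_left)
  also have "\<dots> \<le> P * (N1 * (1 + d * K)) + \<delta> / 2 * n"
    using R(2) by (intro add_left_mono mult_right_mono) auto
  finally have unmatched: "real (card ({1..n} - M)) \<le> real (P * (N1 * (1 + d * K))) + \<delta> / 2 * n"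
    by simp
  \<comment> \<open>One half of \<open>\<delta> * n\<close> has been spent on rounding; the other
    half absorbs \<open>C\<close>.\<close>
  have "C \<le> \<delta> / 2 * n" using L1(1) \<delta>(1) by (simp add: field_simps)
  then have "real (P * (N1 * (1 + d * K))) + 4 * q * K + 2 * q * \<delta> \<le> \<delta> / 2 * n"
    by (simp add: C_def)
  with unmatched have "real (card ({1..n} - M)) + 4 * q * K \<le> \<delta> * (real n - 2 * q)"
    by (simp add: algebra_simps)
  then have "accepting {1..n} f t {} id \<le> accepting {1..n} g t {} id + q * \<delta> * fact (card {1..n})"
    using M(1-4) \<delta>(1) t(1)
    by (intro accepting_le[OF _ f(1) g(1), where M = M and \<phi> = \<phi>]) (auto simp: K_def d_def)
  also have "q * \<delta> * fact (card {1..n}) \<le> 1 / 2 * fact (card {1..n})"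
    using \<delta>(2) by (rule mult_right_mono) simp
  also have "card {1..n} = n" by simp
  finally show False using t(2) by linarith
qed

end
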